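(* Let $\mathfrak h$ be a real nilpotent Lie algebra of type $\{n,2\}$, $n\ge3$, let $T\cong\mathrm{SO}_2(\mathbb R)$ be a group of automorphisms of $\mathfrak h$ such that $\mathfrak h$ is $T$-undecomposable, and let $\alpha_h,\beta$ be the coefficients of the action of $T$ described in the context. Assume $\beta=1$ and that the smallest coefficient $\alpha_h$, denoted $\alpha$, is greater than $\frac12$. Then there are an integer $l\ge0$ and a basis $\{e_1,\dots,e_n,x,y\}$ of $\mathfrak h$, with $\{x,y\}$ a basis of $\mathfrak h'$, with respect to which $T$ operates as the group of automorphisms $\exp(\partial(t))$, $t\in\mathbb R$, where $$\partial(t)=t\cdot\Big((\oplus \alpha J)\oplus(\oplus (\alpha+1) J)\oplus\dots\oplus(\oplus (\alpha+l) J)\Big)\oplus t\cdot J,$$ the diagonal block $(\oplus(\alpha+i-1)J)$ having dimension $d_i\times d_i$ ($1\le i\le l+1$, $d_i$ even), and $\mathfrak h$ is described by the pair of alternating matrices $(T_1,T_2)$, where $$T_1=\left(\begin{array}{c|c|c|c|c|c} 0&W_1&&&&\\ \hline -W_1'&0&W_2&&&\\ \hline &-W_2'&0&W_3&&\\ \hline &&-W_3'&\ddots&\ddots&\\ \hline &&&\ddots&0&W_{l}\\ \hline &&&&-W_{l}'&0 \end{array}\right)$$ and $T_2$ is the alternating matrix obtained from $T_1$ by replacing each block $W_i$ by $W_i(\oplus J)$ (and $-W_i'$ by $-(W_i(\oplus J))'$). The block $W_i$ has dimension $d_i\times d_{i+1}$ and is the real form of a complex matrix $\widehat W_i$ of the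 almost echelon form $\widehat W_i=(0\,|\,\widetilde I_{r_i})$ (and, in particular, $\widehat W_1=(0\,|\,I_{r_1})$ and $\widehat W_l=\widetilde I_{r_l}$), where $\widetilde I_{r_i}$ is obtained from the complex identity matrix $I_{r_i}$ by adding zero rows; and no two successive columns of $T_1$ of indices $2j-1,2j$ are both zero.
   Context: All Lie algebras are real and finite-dimensional. A nilpotent Lie algebra $\mathfrak h$ of type $\{n,2\}$ is one of dimension $n+2$ whose commutator ideal $\mathfrak h'$ is $2$-dimensional and coincides with the centre of $\mathfrak h$. Given a basis $\{e_1,\dots,e_n,x,y\}$ of $\mathfrak h$ with $\{x,y\}$ a basis of $\mathfrak h'$, the pair of alternating $n\times n$ real matrices $(T_1=(a_{ij}),T_2=(b_{ij}))$ describing $\mathfrak h$ is defined by $[e_i,e_j]=a_{ij}x+b_{ij}y$. Let $J=\begin{pmatrix}0&1\\-1&0\end{pmatrix}$. $A\oplus B$ is the block diagonal matrix with blocks $A,B$; $(\oplus A)=A\oplus\cdots\oplus A$ (a number of copies determined by the sizes). $A'$ is the transpose of $A$; $I_k$ is the $k\times k$ identity. In block matrices blank blocks are zero and $0$ denotes a zero block of suitable size. Matrices of linear maps act on coordinate columns. Action of $T$: let $T\cong\mathrm{SO}_2(\mathbb R)$ be a group of automorphisms of $\mathfrak h$ and $\mathfrak t$ the corresponding Lie algebra of derivations. Write $n=2m$ or $n=2m+1$. By complete reducibility there is a basis $\{e_1,\dots,e_n,x,y\}$ with $\{x,y\}$ a basis of $\mathfrak h'$ in which $\mathfrak t$ consists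 of the matrices $\partial(t)=(\alpha_1tJ\oplus\cdots\oplus\alpha_mtJ)\oplus\beta tJ$ if $n=2m$, and $\partial(t)=(0\oplus\alpha_1tJ\oplus\cdots\oplus\alpha_mtJ)\oplus\beta tJ$ if $n=2m+1$ (with a $1\times1$ block $0$ first), $t\in\mathbb R$, where $\beta tJ$ acts on $\langle x,y\rangle$; one can choose $0\le\alpha_1\le\dots\le\alpha_m$ and (rescaling $t$) $\beta\in\{0,1\}$. The coefficients $\alpha_h$ are $\alpha_1,\dots,\alpha_m$, together with $\alpha_0=0$ if $n$ is odd. $\mathfrak h$ is $T$-decomposable if it contains two proper $T$-invariant ideals $\mathfrak i_1,\mathfrak i_2$ such that $\mathfrak h$ is the direct sum of $\mathfrak i_1$ and $\mathfrak i_2$ with amalgamated centre, that is, $\mathfrak h=\mathfrak i_1+\mathfrak i_2$, $[\mathfrak i_1,\mathfrak i_2]=0$ and $\mathfrak i_1\cap\mathfrak i_2=\mathfrak h'$; otherwise it is $T$-undecomposable. Real form: the real form of a complex matrix is the real matrix obtained by replacing each entry $a+ib$ ($a,b\in\mathbb R$) by the block $\begin{pmatrix}a&b\\-b&a\end{pmatrix}$. $\widetilde I_{r}$ denotes a matrix with $r$ columns and rank $r$ obtained from $I_r$ by inserting (possibly no) zero rows in unspecified positions. In $(0\,|\,\widetilde I_{r})$ the zero columns may be absent. *)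

theory Defs
  imports "HOL-Analysis.Analysis" "Jordan_Normal_Form.Matrix"
begin

text \<open>
  A finite-dimensional real Lie algebra is a bracket on a Euclidean space; the inner product is
  used only through the topology, which on a finite-dimensional space does not depend on it.
\<close>

definition lie_bracket :: "('a::euclidean_space \<Rightarrow> 'a \<Rightarrow> 'a) \<Rightarrow> bool" where
  "lie_bracket br \<longleftrightarrow> bilinear br \<and> (\<forall>u. br u u = 0) \<and>
     (\<forall>u v w. br u (br v w) + br v (br w u) + br w (br u v) = 0)"

definition commutator_ideal :: "('a::euclidean_space \<Rightarrow> 'a \<Rightarrow> 'a) \<Rightarrow> 'a set" where
  "commutator_ideal br = span {br u v | u v. True}"

definition lie_centre :: "('a::euclidean_space \<Rightarrow> 'a \<Rightarrow> 'a) \<Rightarrow> 'a set" where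
  "lie_centre br = {z. \<forall>v. br z v = 0}"

fun lower_central :: "('a::euclidean_space \<Rightarrow> 'a \<Rightarrow> 'a) \<Rightarrow> nat \<Rightarrow> 'a set" where
  "lower_central br 0 = UNIV"
| "lower_central br (Suc k) = span {br u v | u v. v \<in> lower_central br k}"

definition nilpotent_bracket :: "('a::euclidean_space \<Rightarrow> 'a \<Rightarrow> 'a) \<Rightarrow> bool" where
  "nilpotent_bracket br \<longleftrightarrow> (\<exists>k. lower_central br k = {0})"

definition nilpotent_type_2 :: "nat \<Rightarrow> ('a::euclidean_space \<Rightarrow> 'a \<Rightarrow> 'a) \<Rightarrow> bool" where
  "nilpotent_type_2 n br \<longleftrightarrow> lie_bracket br \<and> nilpotent_bracket br \<and>
     DIM('a) = n + 2 \<and> dim (commutator_ideal br) = 2 \<and> commutator_ideal br = lie_centre br"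

definition lie_automorphism :: "('a::euclidean_space \<Rightarrow> 'a \<Rightarrow> 'a) \<Rightarrow> ('a \<Rightarrow> 'a) \<Rightarrow> bool" where
  "lie_automorphism br f \<longleftrightarrow> linear f \<and> bij f \<and> (\<forall>u v. f (br u v) = br (f u) (f v))"

definition SO2 :: "(real^2^2) set" where
  "SO2 = {Q. rotation_matrix Q}"

text \<open>
  The isomorphism is one of topological groups. In finite dimension, pointwise continuity is
  continuity for the usual topology of linear maps, and the inverse is then continuous because
  SO(2) is compact. The image of a homomorphism into bijections is a group under composition.
\<close>

definition SO2_automorphism_group ::
  "('a::euclidean_space \<Rightarrow> 'a \<Rightarrow> 'a) \<Rightarrow> ('a \<Rightarrow> 'a) set \<Rightarrow> bool" where
  "SO2_automorphism_group br T \<longleftrightarrow> (\<forall>f\<in>T. lie_automorphism br f) \<and>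
     (\<exists>\<phi>. bij_betw \<phi> SO2 T \<and>
          (\<forall>A\<in>SO2. \<forall>B\<in>SO2. \<phi> (A ** B) = \<phi> A \<circ> \<phi> B) \<and>
          (\<forall>v. continuous_on SO2 (\<lambda>A. \<phi> A v)))"

definition invariant_ideal ::
  "('a::euclidean_space \<Rightarrow> 'a \<Rightarrow> 'a) \<Rightarrow> ('a \<Rightarrow> 'a) set \<Rightarrow> 'a set \<Rightarrow> bool" where
  "invariant_ideal br T I \<longleftrightarrow> subspace I \<and> (\<forall>u. \<forall>v\<in>I. br u v \<in> I) \<and> (\<forall>f\<in>T. f ` I \<subseteq> I)"

definition T_decomposable ::
  "('a::euclidean_space \<Rightarrow> 'a \<Rightarrow> 'a) \<Rightarrow> ('a \<Rightarrow> 'a) set \<Rightarrow> bool" where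
  "T_decomposable br T \<longleftrightarrow>
     (\<exists>I1 I2. invariant_ideal br T I1 \<and> I1 \<noteq> UNIV \<and> invariant_ideal br T I2 \<and> I2 \<noteq> UNIV \<and>
        {u + v | u v. u \<in> I1 \<and> v \<in> I2} = UNIV \<and>
        (\<forall>u\<in>I1. \<forall>v\<in>I2. br u v = 0) \<and>
        I1 \<inter> I2 = commutator_ideal br)"

definition lin_exp :: "('a::euclidean_space \<Rightarrow> 'a) \<Rightarrow> 'a \<Rightarrow> 'a" where
  "lin_exp D v = (\<Sum>k. (D ^^ k) v /\<^sub>R fact k)"

definition lie_algebra_of :: "('a::euclidean_space \<Rightarrow> 'a) set \<Rightarrow> ('a \<Rightarrow> 'a) set" where
  "lie_algebra_of T = {D. linear D \<and> (\<forall>s. lin_exp (\<lambda>v. s *\<^sub>R D v) \<in> T)}"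

definition ordered_basis :: "'a::euclidean_space list \<Rightarrow> bool" where
  "ordered_basis b \<longleftrightarrow> distinct b \<and> independent (set b) \<and> span (set b) = UNIV"

definition adapted_basis ::
  "('a::euclidean_space \<Rightarrow> 'a \<Rightarrow> 'a) \<Rightarrow> nat \<Rightarrow> 'a list \<Rightarrow> 'a \<Rightarrow> 'a \<Rightarrow> bool" where
  "adapted_basis br n es x y \<longleftrightarrow> length es = n \<and> ordered_basis (es @ [x, y]) \<and>
     span {x, y} = commutator_ideal br"

text \<open>Matrices act on coordinate columns: column j holds the coordinates of the image of \<open>b ! j\<close>.\<close>

definition has_matrix ::
  "'a::euclidean_space list \<Rightarrow> ('a \<Rightarrow> 'a) \<Rightarrow> real mat \<Rightarrow> bool" where
  "has_matrix b D M \<longleftrightarrow> linear D \<and> M \<in> carrier_mat (length b) (length b) \<and>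
     (\<forall>j<length b. D (b ! j) = (\<Sum>i<length b. M $$ (i, j) *\<^sub>R b ! i))"

definition J2 :: "real mat" where
  "J2 = mat_of_rows_list 2 [[0, 1], [-1, 0]]"

text \<open>The list \<open>\<alpha>s\<close> is \<open>\<alpha>\<^sub>1, \<dots>, \<alpha>\<^sub>m\<close> with \<open>m = n div 2\<close>.\<close>

definition action_matrix :: "nat \<Rightarrow> real list \<Rightarrow> real \<Rightarrow> real \<Rightarrow> real mat" where
  "action_matrix n \<alpha>s \<beta> t = t \<cdot>\<^sub>m diag_block_mat
     ((if odd n then [0\<^sub>m 1 1] else []) @ map (\<lambda>a. a \<cdot>\<^sub>m J2) \<alpha>s @ [\<beta> \<cdot>\<^sub>m J2])"

definition action_coefficients ::
  "('a::euclidean_space \<Rightarrow> 'a \<Rightarrow> 'a) \<Rightarrow> ('a \<Rightarrow> 'a) set \<Rightarrow> nat \<Rightarrow> real list \<Rightarrow> real \<Rightarrow> bool" where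
  "action_coefficients br T n \<alpha>s \<beta> \<longleftrightarrow>
     length \<alpha>s = n div 2 \<and> sorted \<alpha>s \<and> (\<forall>a\<in>set \<alpha>s. 0 \<le> a) \<and> \<beta> \<in> {0, 1} \<and>
     (\<exists>es x y. adapted_basis br n es x y \<and>
        lie_algebra_of T = {D. \<exists>t. has_matrix (es @ [x, y]) D (action_matrix n \<alpha>s \<beta> t)})"

text \<open>All coefficients \<open>\<alpha>\<^sub>h\<close>, including \<open>\<alpha>\<^sub>0 = 0\<close> if n is odd.\<close>

definition all_coefficients :: "nat \<Rightarrow> real list \<Rightarrow> real set" where
  "all_coefficients n \<alpha>s = (if odd n then {0} else {}) \<union> set \<alpha>s"

definition described_by ::
  "('a::euclidean_space \<Rightarrow> 'a \<Rightarrow> 'a) \<Rightarrow> 'a list \<Rightarrow> 'a \<Rightarrow> 'a \<Rightarrow> real mat \<Rightarrow> real mat \<Rightarrow> bool" where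
  "described_by br es x y T1 T2 \<longleftrightarrow>
     T1 \<in> carrier_mat (length es) (length es) \<and> T2 \<in> carrier_mat (length es) (length es) \<and>
     (\<forall>i<length es. \<forall>j<length es.
        br (es ! i) (es ! j) = T1 $$ (i, j) *\<^sub>R x + T2 $$ (i, j) *\<^sub>R y)"

text \<open>
  Rows and columns are indexed from 0, as everywhere for \<^typ>\<open>real mat\<close>, but blocks are numbered
  from 1: a matrix with \<open>k \<times> k\<close> blocks is given by sizes \<open>d 1, \<dots>, d k\<close> and blocks \<open>B p q\<close> of
  dimension \<open>d p \<times> d q\<close>.
\<close>

definition block_start :: "(nat \<Rightarrow> nat) \<Rightarrow> nat \<Rightarrow> nat" where
  "block_start d p = (\<Sum>k\<in>{1..<p}. d k)"

definition block_of :: "(nat \<Rightarrow> nat) \<Rightarrow> nat \<Rightarrow> nat" where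
  "block_of d i = (LEAST p. i < block_start d (Suc p))"

definition mat_of_blocks ::
  "nat \<Rightarrow> (nat \<Rightarrow> nat) \<Rightarrow> (nat \<Rightarrow> nat \<Rightarrow> real mat) \<Rightarrow> real mat" where
  "mat_of_blocks k d B = Matrix.mat (\<Sum>p\<in>{1..k}. d p) (\<Sum>p\<in>{1..k}. d p)
     (\<lambda>(i, j). let p = block_of d i; q = block_of d j
               in B p q $$ (i - block_start d p, j - block_start d q))"

definition alternating_tridiagonal ::
  "nat \<Rightarrow> (nat \<Rightarrow> nat) \<Rightarrow> (nat \<Rightarrow> real mat) \<Rightarrow> real mat" where
  "alternating_tridiagonal k d W = mat_of_blocks k d
     (\<lambda>p q. if q = Suc p then W p
            else if p = Suc q then - transpose_mat (W q)
            else 0\<^sub>m (d p) (d q))"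

text \<open>\<open>A \<oplus> \<cdots> \<oplus> A\<close>, for a \<open>2 \<times> 2\<close> matrix A, of dimension \<open>d \<times> d\<close> (d even)\<close>

definition rep_diag :: "nat \<Rightarrow> real mat \<Rightarrow> real mat" where
  "rep_diag d A = diag_block_mat (replicate (d div 2) A)"

definition real_form :: "complex mat \<Rightarrow> real mat" where
  "real_form A = Matrix.mat (2 * dim_row A) (2 * dim_col A)
     (\<lambda>(i, j). let z = A $$ (i div 2, j div 2)
               in if even i then (if even j then Re z else Im z)
                  else (if even j then - Im z else Re z))"

text \<open>\<open>\<rho> j\<close> is the row in which row j of the identity matrix ends up.\<close>

definition identity_with_zero_rows :: "nat \<Rightarrow> complex mat \<Rightarrow> bool" where
  "identity_with_zero_rows r B \<longleftrightarrow> (\<exists>\<rho>. strict_mono_on {..<r} \<rho> \<and> (\<forall>j<r. \<rho> j < dim_row B) \<and>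
     B = Matrix.mat (dim_row B) r (\<lambda>(i, j). if i = \<rho> j then 1 else 0))"

definition prepend_zero_cols :: "nat \<Rightarrow> complex mat \<Rightarrow> complex mat" where
  "prepend_zero_cols c B = Matrix.mat (dim_row B) (c + dim_col B)
     (\<lambda>(i, j). if j < c then 0 else B $$ (i, j - c))"

definition almost_echelon :: "nat \<Rightarrow> complex mat \<Rightarrow> bool" where
  "almost_echelon r A \<longleftrightarrow> (\<exists>c B. identity_with_zero_rows r B \<and> A = prepend_zero_cols c B)"

end

theory Submission
  imports Defs
begin

text \<open>
  Let D generate the Lie algebra of T, decompose a T-invariant complement of the centre into its
  real isotypic pieces V(a), on which D^2 = -a^2, and recall that D^2 = -1 on the centre.
  Since all a exceed 1/2, equivariance forces [V(a), V(b)] = 0 unless b = a \<plusminus> 1,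
  and the bracket V(a) \<times> V(a + 1) is a sesquilinear form for the complex structures
  that D induces. So the bracket is a representation of a quiver of type A (with zigzag orientation
  after dualising every second space), and T-undecomposability is indecomposability. As for every
  quiver of type A, an indecomposable representation has all spaces of complex dimension at most 1
  and all maps between nonzero neighbours invertible. Hence every d i is 2, and rescaling a
  generator of each line successively makes every form equal to 1.

  Indecomposability is exploited through one splitting: a D-invariant subspace K of V(a) that is
  annihilated by V(a - 1) extends along V(a), V(a + 1), ... to a direct summand.
  This yields a line at the bottom and injectivity of every form in its second argument.

  That T consists of the exponentials of t D holds because they form a nontrivial connected
  subgroup of a circle.
\<close>

subsection \<open>The isotypic pieces and their splittings\<close>

text \<open>After complexification, the bracket of an eigenvector of D for \<plusminus> i a with one
  for \<plusminus> i b is an eigenvector for some \<plusminus> i a \<plusminus> i b or zero, and on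
  the centre only \<plusminus> i occurs. Hence a nonzero bracket forces b = a + 1, a = b + 1 or a +
  b = 1. The bound 1/2 is there to exclude the last case, in particular brackets inside a single
  V(a). The proof stays over the reals: a complex multiple of v is a combination of v and D v, and
  inverses of scalars show up as divisions by s^2 + t^2. Undecomposability speaks of the whole
  algebra only, so every fact about one piece has to be read off a splitting of everything.
  Splittings are built upwards; towards the pieces below, only the bracket with V(a - 1) can
  interfere, and it vanishes in both applications: at the smallest coefficient, and for the right
  radical of a form. Left radicals need no discussion, because the centre is a complex line: over a
  line V(a), injectivity in the second argument already makes V(a + 1) at most a line.\<close>

lemma bilinear_separating_complement:
  fixes \<phi> :: "'a::euclidean_space \<Rightarrow> 'b::euclidean_space \<Rightarrow> real"
  assumes \<phi>: "bilinear \<phi>" and K: "subspace K" and A: "subspace A"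
    and sep: "\<And>v. v \<in> A \<Longrightarrow> (\<And>k. k \<in> K \<Longrightarrow> \<phi> k v = 0) \<Longrightarrow> v = 0"
  obtains k where "k \<in> K" "\<And>v. v \<in> A \<Longrightarrow> \<phi> (w - k) v = 0"
proof -
  define G where "G v = (\<Sum>b\<in>Basis. \<phi> b v *\<^sub>R b)" for v
  have linl: "linear (\<lambda>u. \<phi> u v)" and linr: "linear (\<lambda>v. \<phi> u v)" for u v
    using \<phi> by (auto simp: bilinear_def)
  have linG: "linear G"
    unfolding G_def
    by (intro linear_compose_sum ballI linear_compose_scale_right)
      (auto intro!: linearI simp: linear_add[OF linr] linear_scale[OF linr] scaleR_add_left)
  have G: "\<phi> u v = inner u (G v)" for u v
  proof -
    have "\<phi> u v = \<phi> (\<Sum>b\<in>Basis. (inner u b) *\<^sub>R b) v"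
      by (simp add: euclidean_representation)
    also have "\<dots> = (\<Sum>b\<in>Basis. (inner u b) * \<phi> b v)"
      by (simp add: linear_sum[OF linl] linear_scale[OF linl])
    also have "\<dots> = inner u (G v)"
      by (simp add: G_def inner_sum_right mult.commute)
    finally show ?thesis .
  qed
  have sGA: "subspace (G ` A)"
    by (rule linear_subspace_image[OF linG A])
  \<comment> \<open>Via \<open>G\<close>, the second summand is the annihilator of \<open>A\<close>.
    The claim \<open>W = UNIV\<close> is transposition: \<open>A\<close> injects into the dual of
    \<open>K\<close>, so \<open>K\<close> maps onto the dual of \<open>A\<close>. Concretely, a
    vector orthogonal to \<open>W\<close> lies in the double complement of \<open>G\<close> applied
    to \<open>A\<close>, hence is some \<open>G v\<close>, and orthogonality to \<open>K\<close>
    makes \<open>v\<close> vanish by \<open>sep\<close>.\<close>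
  define W where "W = {k + m | k m. k \<in> K \<and> m \<in> (G ` A)\<^sup>\<bottom>}"
  have sW: "subspace W"
    unfolding W_def by (rule subspace_sums[OF K subspace_orthogonal_comp])
  have "W = UNIV"
  proof (rule ccontr)
    assume "W \<noteq> UNIV"
    moreover have "span W = W" using sW by simp
    ultimately have "dim W \<noteq> DIM('a)" using dim_eq_full[of W] by metis
    then have "dim W < DIM('a)" using dim_subset_UNIV[of W] by linarith
    then obtain z where "z \<noteq> 0" "\<And>u. u \<in> span W \<Longrightarrow> real_inner_class.orthogonal z u"
      using orthogonal_to_subspace_exists by metis
    then have z: "z \<noteq> 0" "\<And>u. u \<in> W \<Longrightarrow> inner z u = 0"
      using span_base[of _ W] by (auto simp: real_inner_class.orthogonal_def)
    have KW: "K \<subseteq> W" "(G ` A)\<^sup>\<bottom> \<subseteq> W"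
      unfolding W_def using subspace_0[OF K] subspace_0[OF subspace_orthogonal_comp, of "G ` A"]
      by force+
    have "z \<in> (G ` A)\<^sup>\<bottom>\<^sup>\<bottom>"
      using z(2) KW(2) unfolding orthogonal_comp_def[of "orthogonal_comp _"]
      by (auto simp: real_inner_class.orthogonal_def inner_commute)
    then obtain v where v: "v \<in> A" "z = G v"
      using orthogonal_comp_self[OF sGA] by auto
    have "\<phi> k v = 0" if "k \<in> K" for k
      using z(2)[of k] KW(1) that v(2) by (auto simp: G inner_commute)
    then have "v = 0" using sep v(1) by blast
    then show False using z(1) v(2) linear_0[OF linG] by simp
  qed
  then obtain k m where km: "k \<in> K" "m \<in> (G ` A)\<^sup>\<bottom>" "w = k + m"
    unfolding W_def by blast
  have "\<phi> (w - k) v = 0" if "v \<in> A" for v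
    using km(2,3) that by (auto simp: G orthogonal_comp_def real_inner_class.orthogonal_def inner_commute)
  with km(1) show ?thesis using that by blast
qed

text \<open>The grading is given by projections \<open>pr a\<close>, so that components are linear
  functions of a vector. They are indexed by all reals and vanish off \<open>S\<close>, which lets
  neighbours a - 1 and a + 1 be mentioned without side conditions. The signs of \<open>D x\<close>
  and \<open>D y\<close> are those of J acting on columns.\<close>

locale graded_derivation =
  fixes br :: "'a::euclidean_space \<Rightarrow> 'a \<Rightarrow> 'a" and D :: "'a \<Rightarrow> 'a"
    and pr :: "real \<Rightarrow> 'a \<Rightarrow> 'a" and S :: "real set" and x y :: 'a
  assumes bil: "bilinear br" and alt: "br u u = 0"
    and br_mem: "br u v \<in> span {x, y}" and central: "z \<in> span {x, y} \<Longrightarrow> br z v = 0"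
    and linD: "linear D" and der: "D (br u v) = br (D u) v + br u (D v)"
    and Dx: "D x = - y" and Dy: "D y = x"
    and indep: "independent {x, y}" and xy: "x \<noteq> y"
    and linpr: "linear (pr a)" and pr_pr: "pr a (pr b v) = (if a = b then pr a v else 0)"
    and pr_D: "pr a (D v) = D (pr a v)" and DD_pr: "D (D (pr a v)) = - (a\<^sup>2) *\<^sub>R pr a v"
    and pr_Z: "z \<in> span {x, y} \<Longrightarrow> pr a z = 0"
    and finS: "finite S" and pr_notin: "a \<notin> S \<Longrightarrow> pr a v = 0"
    and pr_sum: "v - (\<Sum>a\<in>S. pr a v) \<in> span {x, y}"
    and S_gt: "a \<in> S \<Longrightarrow> a > 1/2"
begin

definition V :: "real \<Rightarrow> 'a set" where "V a = range (pr a)"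

text \<open>For nonzero a these are the complex subspaces of \<open>V a\<close> with respect to the
  complex structure D / a.\<close>

definition inv_sub :: "real \<Rightarrow> 'a set \<Rightarrow> bool" where
  "inv_sub a K \<longleftrightarrow> subspace K \<and> K \<subseteq> V a \<and> (\<forall>v\<in>K. D v \<in> K)"

text \<open>A direct sum decomposition of the quiver representation over the vertices in
  \<open>X\<close>. The set \<open>X\<close> varies because the recursion works on an upward string,
  whereas decomposability of the algebra concerns \<open>S\<close>.\<close>

definition splits :: "real set \<Rightarrow> (real \<Rightarrow> 'a set) \<Rightarrow> (real \<Rightarrow> 'a set) \<Rightarrow> bool" where
  "splits X P Q \<longleftrightarrow>
     (\<forall>b\<in>X. inv_sub b (P b) \<and> inv_sub b (Q b) \<and> P b \<inter> Q b \<subseteq> {0} \<and>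
        (\<forall>v\<in>V b. \<exists>p\<in>P b. \<exists>q\<in>Q b. v = p + q)) \<and>
     (\<forall>b\<in>X. \<forall>c\<in>X. \<forall>u\<in>P b. \<forall>v\<in>Q c. br u v = 0)"

definition up :: "real \<Rightarrow> real set" where "up a = range (\<lambda>i::nat. a + real i)"

lemma splitsD:
  assumes "splits X P Q" "b \<in> X"
  shows "inv_sub b (P b)" "inv_sub b (Q b)" "P b \<inter> Q b \<subseteq> {0}"
    "\<And>v. v \<in> V b \<Longrightarrow> \<exists>p\<in>P b. \<exists>q\<in>Q b. v = p + q"
    "\<And>c u v. c \<in> X \<Longrightarrow> u \<in> P b \<Longrightarrow> v \<in> Q c \<Longrightarrow> br u v = 0"
  using assms unfolding splits_def by blast+

lemma inv_subD:
  assumes "inv_sub a K"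
  shows "subspace K" "K \<subseteq> V a" "\<And>v. v \<in> K \<Longrightarrow> D v \<in> K" "0 \<in> K"
  using assms subspace_0[of K] by (auto simp: inv_sub_def)

lemma linear_br_left: "linear (\<lambda>u. br u v)" and linear_br_right: "linear (br u)"
  using bil by (auto simp: bilinear_def)

lemmas br_linear_simps =
  linear_add[OF linear_br_left] linear_diff[OF linear_br_left] linear_scale[OF linear_br_left]
  linear_0[OF linear_br_left] linear_neg[OF linear_br_left]
  linear_add[OF linear_br_right] linear_diff[OF linear_br_right] linear_scale[OF linear_br_right]
  linear_0[OF linear_br_right] linear_neg[OF linear_br_right]

lemmas D_linear_simps =
  linear_add[OF linD] linear_diff[OF linD] linear_scale[OF linD] linear_0[OF linD] linear_neg[OF linD]

lemma br_commute: "br v u = - br u v"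
proof -
  have "br (u + v) (u + v) = br u u + br v u + (br u v + br v v)"
    by (simp only: br_linear_simps)
  then show ?thesis by (simp add: alt eq_neg_iff_add_eq_0)
qed

lemma span_xy_E:
  assumes "z \<in> span {x, y}" obtains s t where "z = s *\<^sub>R x + t *\<^sub>R y"
proof -
  obtain s t where "z - s *\<^sub>R x - t *\<^sub>R y = 0"
    using assms unfolding span_breakdown_eq span_empty by auto
  then show ?thesis using that[of s t] by (simp add: algebra_simps)
qed

lemma DD_Z: "z \<in> span {x, y} \<Longrightarrow> D (D z) = - z"
  by (elim span_xy_E) (simp add: D_linear_simps Dx Dy)

lemma mem_V: "v \<in> V a \<longleftrightarrow> pr a v = v"
  by (auto simp: V_def pr_pr image_iff intro: exI[of _ v])

lemma subspace_V: "subspace (V a)"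
  unfolding V_def by (rule linear_subspace_image[OF linpr subspace_UNIV])

lemma D_V: "v \<in> V a \<Longrightarrow> D v \<in> V a"
  by (simp add: mem_V pr_D)

lemma DD_V: "v \<in> V a \<Longrightarrow> D (D v) = - (a\<^sup>2) *\<^sub>R v"
  using DD_pr[of a v] by (simp add: mem_V)

lemma V_notin: "a \<notin> S \<Longrightarrow> V a = {0}"
  using pr_notin by (auto simp: V_def)

lemma inv_sub_V: "inv_sub a (V a)"
  by (simp add: inv_sub_def subspace_V D_V)

lemma inv_sub_0: "inv_sub a {0}"
  using subspace_0[OF subspace_V] by (simp add: inv_sub_def linear_0[OF linD])

text \<open>The real form of the eigenvalue argument: D maps the span of the four brackets of u, D u
  with v, D v to itself, and \<open>DD_Z\<close> turns this into linear relations whose elimination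
  leaves a scalar multiple of \<open>br u v\<close>.\<close>

lemma br_V_cases:
  assumes u: "u \<in> V a" and v: "v \<in> V b"
  shows "br u v = 0 \<or> b = a + 1 \<or> a = b + 1"
proof (cases "a \<in> S \<and> b \<in> S")
  case False
  then show ?thesis using u v V_notin by (auto simp: br_linear_simps)
next
  case True
  then have ab: "a > 1/2" "b > 1/2" using S_gt by auto
  define p q r s where "p = br u v" and "q = br (D u) v" and "r = br u (D v)" and "s = br (D u) (D v)"
  have Dp: "D p = q + r"
    by (simp add: p_def q_def r_def der)
  have Dq: "D q = s - a\<^sup>2 *\<^sub>R p" and Dr: "D r = s - b\<^sup>2 *\<^sub>R p"
    by (simp_all add: p_def q_def r_def s_def der DD_V[OF u] DD_V[OF v] br_linear_simps)
  have Ds: "D s = - (a\<^sup>2 *\<^sub>R r) - b\<^sup>2 *\<^sub>R q"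
    by (simp add: q_def r_def s_def der DD_V[OF u] DD_V[OF v] br_linear_simps)
  have "- p = D (D p)" by (simp add: p_def DD_Z[OF br_mem])
  also have "\<dots> = 2 *\<^sub>R s - (a\<^sup>2 + b\<^sup>2) *\<^sub>R p"
    by (simp add: Dp D_linear_simps Dq Dr algebra_simps scaleR_2)
  finally have 1: "2 *\<^sub>R s = (a\<^sup>2 + b\<^sup>2 - 1) *\<^sub>R p" by (simp add: algebra_simps)
  have "- s = D (D s)" by (simp add: s_def DD_Z[OF br_mem])
  also have "\<dots> = (2 * a\<^sup>2 * b\<^sup>2) *\<^sub>R p - (a\<^sup>2 + b\<^sup>2) *\<^sub>R s"
    by (simp add: Ds D_linear_simps Dq Dr algebra_simps scaleR_2 flip: scaleR_scaleR) (simp add: algebra_simps flip: scaleR_add_left)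
  finally have 2: "(2 * a\<^sup>2 * b\<^sup>2) *\<^sub>R p = (a\<^sup>2 + b\<^sup>2 - 1) *\<^sub>R s" by (simp add: algebra_simps)
  have "(4 * a\<^sup>2 * b\<^sup>2) *\<^sub>R p = (a\<^sup>2 + b\<^sup>2 - 1) *\<^sub>R (2 *\<^sub>R s)"
    using arg_cong[OF 2, of "\<lambda>w. 2 *\<^sub>R w"] by (simp add: mult_ac)
  also have "\<dots> = (a\<^sup>2 + b\<^sup>2 - 1)\<^sup>2 *\<^sub>R p" unfolding 1 by (simp add: power2_eq_square)
  finally have "(4 * a\<^sup>2 * b\<^sup>2 - (a\<^sup>2 + b\<^sup>2 - 1)\<^sup>2) *\<^sub>R p = 0" by (simp add: scaleR_diff_left)
  \<comment> \<open>As a and b exceed 1/2, the factors a + b - 1 and a + b + 1 are positive; the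
    other two vanish exactly in the two exceptional cases.\<close>
  moreover have "4 * a\<^sup>2 * b\<^sup>2 - (a\<^sup>2 + b\<^sup>2 - 1)\<^sup>2 = (a + b - 1) * (a + b + 1) * (1 + a - b) * (1 + b - a)"
    by (simp add: power2_eq_square algebra_simps)
  ultimately show ?thesis using ab by (auto simp: p_def)
qed

text \<open>With the complex structures D / a on \<open>V a\<close>, D / (a + 1) on
  \<open>V (a + 1)\<close> and D on the centre, where the denominators are nonzero, this says that
  the bracket is conjugate-linear in u and linear in v.\<close>

lemma br_shift:
  assumes u: "u \<in> V a" and v: "v \<in> V (a + 1)"
  shows "br (D u) v = - a *\<^sub>R D (br u v)" and "br u (D v) = (a + 1) *\<^sub>R D (br u v)"
proof -
  define b where "b = a + 1"
  define p q r s where "p = br u v" and "q = br (D u) v" and "r = br u (D v)" and "s = br (D u) (D v)"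
  have Dp: "D p = q + r"
    by (simp add: p_def q_def r_def der)
  have Dq: "D q = s - a\<^sup>2 *\<^sub>R p" and Dr: "D r = s - b\<^sup>2 *\<^sub>R p"
    by (simp_all add: p_def q_def r_def s_def b_def der DD_V[OF u] DD_V[OF v] br_linear_simps)
  have "- p = D (D p)" by (simp add: p_def DD_Z[OF br_mem])
  also have "\<dots> = 2 *\<^sub>R s - (a\<^sup>2 + b\<^sup>2) *\<^sub>R p"
    by (simp add: Dp D_linear_simps Dq Dr algebra_simps scaleR_2)
  finally have "2 *\<^sub>R s = (a\<^sup>2 + b\<^sup>2 - 1) *\<^sub>R p" by (simp add: algebra_simps)
  also have "a\<^sup>2 + b\<^sup>2 - 1 = 2 * (a * b)" by (simp add: b_def power2_eq_square algebra_simps)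
  finally have "2 *\<^sub>R s = 2 *\<^sub>R ((a * b) *\<^sub>R p)" by simp
  then have s: "s = (a * b) *\<^sub>R p" unfolding scaleR_cancel_left by simp
  \<comment> \<open>D is invertible on the centre with inverse - D, so applying D once more recovers
    q from D q.\<close>
  have "D q = a *\<^sub>R p" unfolding Dq s by (simp add: b_def power2_eq_square algebra_simps)
  then have "D (D q) = a *\<^sub>R D p" by (simp add: D_linear_simps)
  moreover have "D (D q) = - q" by (simp add: q_def DD_Z[OF br_mem])
  ultimately show q: "br (D u) v = - a *\<^sub>R D (br u v)"
    by (simp add: p_def q_def)
  show "br u (D v) = (a + 1) *\<^sub>R D (br u v)"
    using q der[of u v] by (simp add: algebra_simps)
qed

text \<open>A \<open>C\<close> of maximal dimension works: an m outside K + C would allow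
  \<open>C\<close> to be enlarged by the complex line through m. \<open>K\<close> need not lie in
  \<open>M\<close>; in the application \<open>M\<close> is an annihilator that meets
  \<open>K\<close> arbitrarily.\<close>

lemma inv_complement:
  assumes K: "inv_sub a K" and M: "inv_sub a M" and a: "a \<in> S"
  obtains C where "inv_sub a C" "C \<subseteq> M" "K \<inter> C \<subseteq> {0}"
    "\<And>m. m \<in> M \<Longrightarrow> \<exists>k\<in>K. \<exists>c\<in>C. m = k + c"
proof -
  have a0: "a \<noteq> 0" using S_gt[OF a] by auto
  define good where "good C \<longleftrightarrow> inv_sub a C \<and> C \<subseteq> M \<and> K \<inter> C \<subseteq> {0}" for C
  have "good {0}"
    using inv_subD(4)[OF M] inv_sub_0 by (simp add: good_def)
  then obtain C where C: "good C" and max: "\<And>C'. good C' \<Longrightarrow> dim C' \<le> dim C"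
    using ex_has_greatest_nat[of good "{0}" dim "Suc (DIM('a))"]
    by (auto simp: dim_subset_UNIV less_Suc_eq_le)
  have sC: "subspace C" and sK: "subspace K" and sM: "subspace M" and MV: "M \<subseteq> V a"
    and DC: "\<And>v. v \<in> C \<Longrightarrow> D v \<in> C" and DK: "\<And>v. v \<in> K \<Longrightarrow> D v \<in> K" and DM: "\<And>v. v \<in> M \<Longrightarrow> D v \<in> M"
    and CM: "C \<subseteq> M" and KC: "K \<inter> C \<subseteq> {0}"
    using C K M by (auto simp: good_def inv_sub_def)
  define W where "W = {k + c | k c. k \<in> K \<and> c \<in> C}"
  have sW: "subspace W" unfolding W_def by (rule subspace_sums[OF sK sC])
  have KW: "K \<subseteq> W" and CW: "C \<subseteq> W"
    unfolding W_def using subspace_0[OF sK] subspace_0[OF sC] by force+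
  have DW: "D w \<in> W" if "w \<in> W" for w
    using that DC DK by (force simp: W_def D_linear_simps)
  have "m \<in> W" if m: "m \<in> M" for m
  proof (rule ccontr)
    assume mW: "m \<notin> W"
    define C' where "C' = {c + v | c v. c \<in> C \<and> v \<in> span {m, D m}}"
    have sC': "subspace C'"
      unfolding C'_def by (rule subspace_sums[OF sC subspace_span])
    have span_E: "\<exists>s t. v = s *\<^sub>R m + t *\<^sub>R D m" if v: "v \<in> span {m, D m}" for v
    proof -
      obtain s t where "v - s *\<^sub>R m - t *\<^sub>R D m \<in> span {}"
        using v unfolding span_breakdown_eq by blast
      then have "v - s *\<^sub>R m - t *\<^sub>R D m = 0" by simp
      then have "v = s *\<^sub>R m + t *\<^sub>R D m" by (simp add: algebra_simps)
      then show ?thesis by blast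
    qed
    have span_I: "s *\<^sub>R m + t *\<^sub>R D m \<in> span {m, D m}" for s t
      by (intro span_add span_scale span_base) auto
    have DDm: "D (D m) = - (a\<^sup>2) *\<^sub>R m" using m MV DD_V by blast
    have "D w \<in> C'" if w: "w \<in> C'" for w
    proof -
      obtain c v where cv: "c \<in> C" "v \<in> span {m, D m}" "w = c + v" using w by (auto simp: C'_def)
      obtain s t where st: "v = s *\<^sub>R m + t *\<^sub>R D m" using span_E cv(2) by blast
      have "D v = (- (t * a\<^sup>2)) *\<^sub>R m + s *\<^sub>R D m" by (simp add: st D_linear_simps DDm)
      then have "D v \<in> span {m, D m}" using span_I by metis
      then show ?thesis using cv DC by (auto simp: C'_def D_linear_simps)
    qed
    moreover have "C' \<subseteq> M"
      using CM m DM span_minimal[of "{m, D m}" M] sM subspace_add by (fastforce simp: C'_def)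
    moreover have "K \<inter> C' \<subseteq> {0}"
    proof
      fix k assume k: "k \<in> K \<inter> C'"
      then obtain c v where cv: "c \<in> C" "v \<in> span {m, D m}" "k = c + v" by (auto simp: C'_def)
      obtain s t where st: "v = s *\<^sub>R m + t *\<^sub>R D m" using span_E cv(2) by blast
      have "v = k - c" using cv by simp
      then have vW: "v \<in> W" using k cv KW CW subspace_diff[OF sW] by blast
      \<comment> \<open>Multiplication by the conjugate scalar: a nonzero vector of the complex line
        through m would bring m itself into \<open>W\<close>.\<close>
      have "s *\<^sub>R v - t *\<^sub>R D v \<in> W" using vW DW sW by (intro subspace_diff subspace_scale) auto
      moreover have "s *\<^sub>R v - t *\<^sub>R D v = (s\<^sup>2 + t\<^sup>2 * a\<^sup>2) *\<^sub>R m"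
        by (simp add: st D_linear_simps DDm algebra_simps power2_eq_square)
      ultimately have "(s\<^sup>2 + t\<^sup>2 * a\<^sup>2) *\<^sub>R m \<in> W" by simp
      then have "s\<^sup>2 + (t * a)\<^sup>2 = 0"
        using mW subspace_scale[OF sW, of "(s\<^sup>2 + t\<^sup>2 * a\<^sup>2) *\<^sub>R m" "inverse (s\<^sup>2 + t\<^sup>2 * a\<^sup>2)"]
        by (cases "s\<^sup>2 + t\<^sup>2 * a\<^sup>2 = 0") (auto simp: power_mult_distrib)
      then have "v = 0" using a0 by (simp add: sum_power2_eq_zero_iff st)
      then show "k \<in> {0}" using KC k cv by auto
    qed
    ultimately have "good C'"
      using sC' MV by (auto simp: good_def inv_sub_def)
    then have "dim C' \<le> dim C" by (rule max)
    moreover have sub: "C \<subseteq> C'" using span_0 by (force simp: C'_def)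
    ultimately have "C = C'"
      using subspace_dim_equal[OF sC sC'] by simp
    moreover have "m \<in> C'" using subspace_0[OF sC] span_base[of m "{m, D m}"] by (force simp: C'_def)
    ultimately show False using CW mW by blast
  qed
  then show ?thesis using that[of C] C by (fastforce simp: good_def W_def)
qed

text \<open>Taking \<xi> to be the x-coordinate, \<xi> (D p) is the y-coordinate of p. On
  D-invariant subspaces the vanishing of the centre-valued bracket thereby reduces to that of one
  real bilinear form.\<close>

lemma functional_exists:
  obtains \<xi> :: "'a \<Rightarrow> real" where "linear \<xi>"
    "\<And>p. p \<in> span {x, y} \<Longrightarrow> \<xi> p = 0 \<Longrightarrow> \<xi> (D p) = 0 \<Longrightarrow> p = 0"
proof -
  obtain \<xi> :: "'a \<Rightarrow> real" where \<xi>: "linear \<xi>" "\<forall>v\<in>{x, y}. \<xi> v = (if v = x then 1 else 0)"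
    using linear_independent_extend[OF indep, of "\<lambda>v. if v = x then 1 else 0"] by blast
  then have xi: "\<xi> x = 1" "\<xi> y = 0" using xy by auto
  have "p = 0" if "p \<in> span {x, y}" "\<xi> p = 0" "\<xi> (D p) = 0" for p
    using that
    by (elim span_xy_E) (simp add: linear_add[OF \<xi>(1)] linear_scale[OF \<xi>(1)] linear_neg[OF \<xi>(1)] xi D_linear_simps Dx Dy)
  then show ?thesis using that \<xi>(1) by blast
qed

section \<open>Splitting the string of pieces upwards from a\<close>

lemma up_Suc: "up a = insert a (up (a + 1))"
proof -
  have "range (\<lambda>i::nat. a + real i) = (\<lambda>i. a + real i) ` insert 0 (range Suc)"
    by (simp flip: UNIV_nat_eq)
  then show ?thesis by (simp add: up_def image_image add.assoc)
qed

lemma up_ge: "b \<in> up a \<Longrightarrow> a \<le> b"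
  by (auto simp: up_def)

lemma up_self: "a \<in> up a"
  using up_Suc[of a] by blast

lemma up_closed: "b \<in> up a \<Longrightarrow> b + 1 \<in> up a"
  by (auto simp: up_def image_iff) (metis of_nat_Suc add.commute)

lemma up_pred: "b \<in> up a \<Longrightarrow> b \<noteq> a \<Longrightarrow> b - 1 \<in> up a"
proof -
  assume "b \<in> up a" "b \<noteq> a"
  then obtain i where "b = a + real i" "i \<noteq> 0" by (auto simp: up_def)
  then have "b - 1 = a + real (i - 1)" by (simp add: of_nat_diff)
  then show ?thesis by (auto simp: up_def)
qed

text \<open>
  The annihilator of \<open>K\<close> in \<open>V (a + 1)\<close> is split off first; its complement \<open>A\<close> pairs injectively
  into the dual of \<open>K\<close>, so \<open>K\<close> and the annihilator of \<open>A\<close> together fill \<open>V a\<close>.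
\<close>

lemma splits_up_aux:
  assumes "inv_sub a K" and "\<And>i. i \<ge> N \<Longrightarrow> a + real i \<notin> S"
  shows "\<exists>P Q. splits (up a) P Q \<and> P a = K"
  using assms
proof (induction N arbitrary: a K)
  case 0
  then have V0: "V b = {0}" if "b \<in> up a" for b
    using that V_notin by (auto simp: up_def)
  have "K = {0}"
    using 0(1) V0[OF up_self] subspace_0 by (auto simp: inv_sub_def)
  then show ?case
    using inv_sub_0 V0
    by (intro exI[of _ "\<lambda>_. {0}"]) (auto simp: splits_def br_linear_simps)
next
  case (Suc N)
  show ?case
  proof (cases "a \<in> S")
    case aS: True
    have a0: "a > 0" using S_gt[OF aS] by simp
    have sK: "subspace K" and KV: "\<And>k. k \<in> K \<Longrightarrow> k \<in> V a" and DK: "\<And>v. v \<in> K \<Longrightarrow> D v \<in> K"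
      using Suc.prems(1) by (auto simp: inv_sub_def)
    define L where "L = {v \<in> V (a + 1). \<forall>k\<in>K. br k v = 0}"
    have iL: "inv_sub (a + 1) L"
      unfolding inv_sub_def
      using subspace_V[of "a + 1"] D_V br_shift(2)[OF KV]
      by (auto simp: L_def subspace_def br_linear_simps linear_0[OF linD])
    have "a + 1 + real i \<notin> S" if "i \<ge> N" for i
      using Suc.prems(2)[of "Suc i"] that by (simp add: add_ac)
    then obtain P' Q' where s: "splits (up (a + 1)) P' Q'" and P'L: "P' (a + 1) = L"
      using Suc.IH[OF iL] by blast
    define A where "A = Q' (a + 1)"
    have iA: "inv_sub (a + 1) A" and LA: "L \<inter> A \<subseteq> {0}"
      using splitsD(2,3)[OF s up_self] P'L by (auto simp: A_def)
    have sA: "subspace A" and AV: "\<And>v. v \<in> A \<Longrightarrow> v \<in> V (a + 1)" and DA: "\<And>v. v \<in> A \<Longrightarrow> D v \<in> A"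
      using iA by (auto simp: inv_sub_def)
    obtain \<xi> :: "'a \<Rightarrow> real" where \<xi>: "linear \<xi>"
      "\<And>p. p \<in> span {x, y} \<Longrightarrow> \<xi> p = 0 \<Longrightarrow> \<xi> (D p) = 0 \<Longrightarrow> p = 0"
      using functional_exists by blast
    have bil\<xi>: "bilinear (\<lambda>u v. \<xi> (br u v))"
      using linear_compose[OF linear_br_left \<xi>(1)] linear_compose[OF linear_br_right \<xi>(1)]
      by (simp add: bilinear_def o_def)
    \<comment> \<open>Invariance of \<open>K\<close> under D supplies the second coordinate: testing
      against D k amounts to applying \<xi> after D.\<close>
    have sep: "v = 0" if v: "v \<in> A" and 0: "\<And>k. k \<in> K \<Longrightarrow> \<xi> (br k v) = 0" for v
    proof -
      have "br k v = 0" if k: "k \<in> K" for k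
      proof (rule \<xi>(2)[OF br_mem 0[OF k]])
        have "- a * \<xi> (D (br k v)) = \<xi> (br (D k) v)"
          by (simp add: br_shift(1)[OF KV[OF k] AV[OF v]] linear_scale[OF \<xi>(1)] linear_neg[OF \<xi>(1)])
        then show "\<xi> (D (br k v)) = 0" using 0[OF DK[OF k]] a0 by simp
      qed
      then have "v \<in> L" using AV[OF v] by (simp add: L_def)
      then show ?thesis using LA v by blast
    qed
    define M where "M = {w \<in> V a. \<forall>v\<in>A. br w v = 0}"
    have iM: "inv_sub a M"
      unfolding inv_sub_def
      using subspace_V[of a] D_V br_shift(1)[OF _ AV]
      by (auto simp: M_def subspace_def br_linear_simps linear_0[OF linD])
    have fill: "\<exists>k\<in>K. w - k \<in> M" if w: "w \<in> V a" for w
    proof -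
      obtain k where k: "k \<in> K" "\<And>v. v \<in> A \<Longrightarrow> \<xi> (br (w - k) v) = 0"
        using bilinear_separating_complement[OF bil\<xi> sK sA sep, of w] by blast
      have wk: "w - k \<in> V a" using w KV[OF k(1)] subspace_diff[OF subspace_V] by blast
      have "br (w - k) v = 0" if v: "v \<in> A" for v
      proof (rule \<xi>(2)[OF br_mem k(2)[OF v]])
        have "(a + 1) * \<xi> (D (br (w - k) v)) = \<xi> (br (w - k) (D v))"
          by (simp add: br_shift(2)[OF wk AV[OF v]] linear_scale[OF \<xi>(1)])
        then show "\<xi> (D (br (w - k) v)) = 0" using k(2)[OF DA[OF v]] a0 by simp
      qed
      then show ?thesis using k(1) wk by (auto simp: M_def)
    qed
    obtain C where C: "inv_sub a C" "C \<subseteq> M" "K \<inter> C \<subseteq> {0}"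
      and KC: "\<And>m. m \<in> M \<Longrightarrow> \<exists>k\<in>K. \<exists>c\<in>C. m = k + c"
      using inv_complement[OF Suc.prems(1) iM aS] by blast
    have VKC: "\<exists>k\<in>K. \<exists>c\<in>C. v = k + c" if "v \<in> V a" for v
    proof -
      obtain k where "k \<in> K" "v - k \<in> M" using fill \<open>v \<in> V a\<close> by blast
      moreover then obtain k' c where "k' \<in> K" "c \<in> C" "v - k = k' + c" using KC by blast
      ultimately show ?thesis
        using subspace_add[OF sK]
        by (intro bexI[of _ "k + k'"] bexI[of _ c]) (auto simp: algebra_simps)
    qed
    have na: "a \<notin> up (a + 1)" using up_ge by fastforce
    \<comment> \<open>The two sides trade places at each step. The recursion delivers
      \<open>L\<close> inside \<open>P'\<close>, but \<open>L\<close> commutes with \<open>K\<close>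
      and pairs with \<open>C\<close>, so it belongs with \<open>C\<close>; dually \<open>A\<close>
      goes with \<open>K\<close>. This is the zigzag orientation of the quiver.\<close>
    let ?P = "Q'(a := K)" and ?Q = "P'(a := C)"
    have "splits (up a) ?P ?Q"
      unfolding splits_def
    proof (intro conjI ballI)
      fix b assume "b \<in> up a"
      then have b: "b = a \<or> b \<noteq> a \<and> b \<in> up (a + 1)" using na by (auto simp: up_Suc[of a])
      then show "inv_sub b (?P b)" "inv_sub b (?Q b)" "?P b \<inter> ?Q b \<subseteq> {0}"
        using splitsD[OF s, of b] C Suc.prems(1) by auto
      show "\<exists>p\<in>?P b. \<exists>q\<in>?Q b. v = p + q" if vV: "v \<in> V b" for v
        using b
      proof
        assume "b = a" then show ?thesis using VKC vV by simp
      next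
        assume b: "b \<noteq> a \<and> b \<in> up (a + 1)"
        then obtain p q where "p \<in> P' b" "q \<in> Q' b" "v = p + q"
          using splitsD(4)[OF s _ vV] by blast
        then show ?thesis
          using b by (intro bexI[of _ q] bexI[of _ p]) (auto simp: add.commute)
      qed
    next
      fix b c u v assume bc: "b \<in> up a" "c \<in> up a" and u: "u \<in> ?P b" and v: "v \<in> ?Q c"
      note iP' = splitsD(1)[OF s] and iQ' = splitsD(2)[OF s]
      have b: "b = a \<or> b \<noteq> a \<and> b \<in> up (a + 1)" and c: "c = a \<or> c \<noteq> a \<and> c \<in> up (a + 1)"
        using bc na by (auto simp: up_Suc[of a])
      have uV: "u \<in> V b" using u b inv_subD(2)[OF iQ', of b] KV by auto
      have vV: "v \<in> V c" using v c inv_subD(2)[OF iP', of c] inv_subD(2)[OF C(1)] by auto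
      \<comment> \<open>Across the join only the pairs K, L and A, C can have nonzero brackets by
        degree. The first vanishes by the choice of \<open>L\<close>, the second because
        \<open>C\<close> lies in \<open>M\<close>.\<close>
      consider "b \<noteq> a" "c \<noteq> a" | "br u v = 0" | "b = a" "c = a + 1" | "b = a + 1" "c = a"
        using br_V_cases[OF uV vV] b c up_ge[of b "a + 1"] up_ge[of c "a + 1"] by fastforce
      then show "br u v = 0"
      proof cases
        case 1
        then have "br v u = 0" using splitsD(5)[OF s, of c b v u] b c u v by auto
        then show ?thesis using br_commute[of u v] by simp
      next
        case 3
        then show ?thesis using u v P'L by (auto simp: L_def)
      next
        case 4
        then have "br v u = 0" using u v C(2) by (auto simp: M_def A_def)
        then show ?thesis using br_commute[of u v] by simp
      qed
    qed
    then show ?thesis by (intro exI conjI) (assumption, simp)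
  next
    case aS: False
    \<comment> \<open>At a gap of \<open>S\<close> the subspace \<open>K\<close> is zero, and
      everything above may be put on one side.\<close>
    then have Va: "V a = {0}" by (rule V_notin)
    then have K0: "K = {0}" using Suc.prems(1) subspace_0 by (auto simp: inv_sub_def)
    have "splits (up a) (\<lambda>_. {0}) V"
      using inv_sub_V inv_sub_0 by (auto simp: splits_def br_linear_simps)
    then show ?thesis using K0 by auto
  qed
qed

lemma splits_up:
  assumes "inv_sub a K"
  obtains P Q where "splits (up a) P Q" "P a = K"
proof -
  obtain M where M: "\<And>s. s \<in> S \<Longrightarrow> s \<le> M" using bdd_above_finite[OF finS] by (auto simp: bdd_above_def)
  obtain N :: nat where N: "real N > M - a" using reals_Archimedean2 by blast
  have "a + real i \<notin> S" if "i \<ge> N" for i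
  proof
    assume "a + real i \<in> S"
    then show False using M[of "a + real i"] N that of_nat_mono[of N i] by fastforce
  qed
  then show ?thesis using splits_up_aux[OF assms] that by blast
qed

lemma splits_imp_T_decomposable:
  assumes s: "splits S P Q" and comm: "commutator_ideal br = span {x, y}"
    and T: "\<And>f W. f \<in> T \<Longrightarrow> subspace W \<Longrightarrow> (\<And>v. v \<in> W \<Longrightarrow> D v \<in> W) \<Longrightarrow> f ` W \<subseteq> W"
    and a: "a \<in> S" "p \<in> P a" "p \<noteq> 0" and b: "b \<in> S" "q \<in> Q b" "q \<noteq> 0"
  shows "T_decomposable br T"
proof -
  have iP: "inv_sub c (P c)" and iQ: "inv_sub c (Q c)" if "c \<in> S" for c
    using splitsD(1,2)[OF s that] .
  \<comment> \<open>This is the sum of all F c and the centre. Described through projections it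
    contains the centre automatically, and intersections can be computed in each degree.\<close>
  define \<II> where "\<II> F = {v. \<forall>c\<in>S. pr c v \<in> F c}" for F
  have sub: "subspace (\<II> F)" if F: "\<And>c. c \<in> S \<Longrightarrow> inv_sub c (F c)" for F
  proof -
    have sF: "subspace (F c)" if "c \<in> S" for c using F[OF that] by (simp add: inv_sub_def)
    show ?thesis
      unfolding subspace_def[of "\<II> F"]
      by (auto simp: \<II>_def linear_0[OF linpr] linear_add[OF linpr]
          linear_scale[OF linpr] intro: subspace_0[OF sF] subspace_add[OF sF] subspace_scale[OF sF])
  qed
  have Z: "span {x, y} \<subseteq> \<II> F" if F: "\<And>c. c \<in> S \<Longrightarrow> inv_sub c (F c)" for F
    using inv_subD(4)[OF F] by (auto simp: \<II>_def pr_Z)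
  have ideal: "invariant_ideal br T (\<II> F)" if F: "\<And>c. c \<in> S \<Longrightarrow> inv_sub c (F c)" for F
    unfolding invariant_ideal_def
  proof (intro conjI sub F allI ballI)
    show "br u v \<in> \<II> F" for u v using br_mem Z[OF F] by blast
    show "f ` \<II> F \<subseteq> \<II> F" if "f \<in> T" for f
    proof (rule T[OF that sub[OF F]])
      show "D v \<in> \<II> F" if "v \<in> \<II> F" for v
        using that inv_subD(3)[OF F] by (auto simp: \<II>_def pr_D)
    qed
  qed auto
  have V_le: "F c \<subseteq> \<II> F" if F: "\<And>c. c \<in> S \<Longrightarrow> inv_sub c (F c)" and c: "c \<in> S" for F c
  proof
    fix v assume v: "v \<in> F c"
    then have "pr c v = v" using F[OF c] by (auto simp: inv_sub_def mem_V)
    then have "pr d v = (if d = c then v else 0)" for d using pr_pr[of d c v] by auto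
    then show "v \<in> \<II> F" using inv_subD(4)[OF F] v by (auto simp: \<II>_def)
  qed
  have PQ: "P c \<inter> Q c \<subseteq> {0}" if "c \<in> S" for c using splitsD(3)[OF s that] .
  have inter: "\<II> P \<inter> \<II> Q = span {x, y}"
  proof
    show "\<II> P \<inter> \<II> Q \<subseteq> span {x, y}"
    proof
      fix v assume "v \<in> \<II> P \<inter> \<II> Q"
      then have "pr c v = 0" if "c \<in> S" for c using PQ that by (auto simp: \<II>_def)
      then show "v \<in> span {x, y}" using pr_sum[of v] by simp
    qed
    show "span {x, y} \<subseteq> \<II> P \<inter> \<II> Q" using Z[OF iP] Z[OF iQ] by blast
  qed
  have neq: "\<II> F \<noteq> UNIV" if c: "c \<in> S" "v \<in> G c" "v \<noteq> 0" and G: "\<And>c. c \<in> S \<Longrightarrow> inv_sub c (G c)"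
    and FG: "F c \<inter> G c \<subseteq> {0}" for F G and c and v
  proof
    assume "\<II> F = UNIV"
    then have "pr c v \<in> F c" using c by (auto simp: \<II>_def)
    moreover have "pr c v = v" using G[OF c(1)] c(2) by (auto simp: inv_sub_def mem_V)
    ultimately show False using c FG by auto
  qed
  have "v \<in> {u + v | u v. u \<in> \<II> P \<and> v \<in> \<II> Q}" for v
  proof -
    have "\<exists>p q. p \<in> P c \<and> q \<in> Q c \<and> pr c v = p + q" if "c \<in> S" for c
      using splitsD(4)[OF s that, of "pr c v"] by (auto simp: V_def)
    then obtain p q where pq: "\<And>c. c \<in> S \<Longrightarrow> p c \<in> P c" "\<And>c. c \<in> S \<Longrightarrow> q c \<in> Q c"
      "\<And>c. c \<in> S \<Longrightarrow> pr c v = p c + q c" by metis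
    let ?z = "v - (\<Sum>c\<in>S. pr c v)"
    have "v = (?z + (\<Sum>c\<in>S. p c)) + (\<Sum>c\<in>S. q c)"
      using pq(3) by (simp add: sum.distrib)
    moreover have "?z + (\<Sum>c\<in>S. p c) \<in> \<II> P"
      using pr_sum[of v] Z[OF iP] V_le[OF iP] pq(1)
      by (intro subspace_add sub[OF iP] subspace_sum) blast+
    moreover have "(\<Sum>c\<in>S. q c) \<in> \<II> Q"
      using V_le[OF iQ] pq(2) by (intro subspace_sum sub[OF iQ]) blast+
    ultimately show ?thesis by blast
  qed
  then have sum: "{u + v | u v. u \<in> \<II> P \<and> v \<in> \<II> Q} = UNIV" by blast
  have br0: "br u v = 0" if u: "u \<in> \<II> P" and v: "v \<in> \<II> Q" for u v
  proof -
    let ?u = "\<Sum>c\<in>S. pr c u" and ?v = "\<Sum>c\<in>S. pr c v"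
    have "br u v = br ?u v + br (u - ?u) v" by (simp add: br_linear_simps)
    also have "br (u - ?u) v = 0" by (rule central[OF pr_sum])
    also have "br ?u v = br ?u ?v + br ?u (v - ?v)" by (simp add: br_linear_simps)
    also have "br ?u (v - ?v) = - br (v - ?v) ?u" by (rule br_commute)
    also have "br (v - ?v) ?u = 0" by (rule central[OF pr_sum])
    also have "br ?u ?v = (\<Sum>c\<in>S. \<Sum>d\<in>S. br (pr c u) (pr d v))"
      by (simp add: linear_sum[OF linear_br_left] linear_sum[OF linear_br_right], rule sum.swap)
    also have "\<dots> = 0"
      using splitsD(5)[OF s] u v by (simp add: \<II>_def)
    finally show ?thesis by simp
  qed
  have "\<II> P \<noteq> UNIV" using neq[where F = P and G = Q, OF b iQ PQ[OF b(1)]] by simp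
  moreover have "Q a \<inter> P a \<subseteq> {0}" using PQ[OF a(1)] by blast
  then have "\<II> Q \<noteq> UNIV" using neq[where F = Q and G = P, OF a iP] by simp
  ultimately show ?thesis
    unfolding T_decomposable_def
    using ideal[OF iP] ideal[OF iQ] sum inter comm br0
    by (intro exI[of _ "\<II> P"] exI[of _ "\<II> Q"] conjI) simp_all
qed

end

section \<open>Consequences of undecomposability: a chain of complex lines\<close>

locale undecomposable_derivation = graded_derivation +
  fixes \<alpha> :: real
  assumes S_nz: "a \<in> S \<Longrightarrow> \<exists>v. pr a v \<noteq> 0"
    and undecomposable: "splits S P Q \<Longrightarrow> (\<forall>a\<in>S. P a \<subseteq> {0}) \<or> (\<forall>a\<in>S. Q a \<subseteq> {0})"
    and \<alpha>_mem: "\<alpha> \<in> S" and \<alpha>_min: "a \<in> S \<Longrightarrow> \<alpha> \<le> a"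
begin

lemma V_nz: "a \<in> S \<Longrightarrow> \<exists>v\<in>V a. v \<noteq> 0"
  using S_nz[of a] by (auto simp: V_def)

text \<open>Split the string above a with \<open>K\<close> on the left, and put every piece off the
  string on the right. The hypothesis \<open>orth\<close> removes the only bracket that could link
  the left side to those pieces. Undecomposability then empties one side: the left one gives K = 0,
  the right one gives the second alternative.\<close>

lemma orthogonal_subspace_cases:
  assumes K: "inv_sub a K" and orth: "\<And>u v. u \<in> V (a - 1) \<Longrightarrow> v \<in> K \<Longrightarrow> br u v = 0"
  shows "K = {0} \<or> (V a = K \<and> (\<forall>b. b \<notin> up a \<longrightarrow> V b = {0}))"
proof (cases "a \<in> S")
  case False
  then show ?thesis using inv_subD(2,4)[OF K] V_notin[of a] by blast
next
  case aS: True
  obtain P Q where s: "splits (up a) P Q" and Pa: "P a = K"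
    using splits_up[OF K] by blast
  define P' where "P' b = (if b \<in> up a then P b else {0})" for b
  define Q' where "Q' b = (if b \<in> up a then Q b else V b)" for b
  have iP: "inv_sub b (P' b)" and iQ: "inv_sub b (Q' b)" for b
    using splitsD(1,2)[OF s, of b] inv_sub_0 inv_sub_V by (auto simp: P'_def Q'_def)
  have "splits S P' Q'"
    unfolding splits_def
  proof (intro conjI ballI iP iQ)
    show "P' b \<inter> Q' b \<subseteq> {0}" for b
      using splitsD(3)[OF s, of b] by (auto simp: P'_def Q'_def)
    show "\<exists>p\<in>P' b. \<exists>q\<in>Q' b. v = p + q" if "v \<in> V b" for b v
      using splitsD(4)[OF s _ that] that by (auto simp: P'_def Q'_def)
    fix b c u v assume u: "u \<in> P' b" and v: "v \<in> Q' c"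
    have uV: "u \<in> V b" and vV: "v \<in> V c" using u v inv_subD(2)[OF iP] inv_subD(2)[OF iQ] by blast+
    show "br u v = 0"
    proof (cases "b \<in> up a")
      case False
      then show ?thesis using u by (simp add: P'_def br_linear_simps)
    next
      case b: True
      show ?thesis
      proof (cases "c \<in> up a")
        case True
        then show ?thesis using b u v splitsD(5)[OF s b True, of u v] by (simp add: P'_def Q'_def)
      next
        case c: False
        \<comment> \<open>A member of \<open>up a\<close> has a neighbour outside it only at the
          lower end.\<close>
        then consider "br u v = 0" | "b = a" "c = a - 1"
          using br_V_cases[OF uV vV] up_closed[OF b] up_pred[OF b] by fastforce
        then show ?thesis
        proof cases
          case 2
          then have "br v u = 0" using orth[of v u] vV u Pa b by (auto simp: P'_def)
          then show ?thesis using br_commute[of u v] by simp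
        qed
      qed
    qed
  qed
  from undecomposable[OF this] show ?thesis
  proof
    assume "\<forall>a\<in>S. P' a \<subseteq> {0}"
    then have "P' a \<subseteq> {0}" using aS by blast
    then have "K \<subseteq> {0}" using Pa up_self[of a] by (simp add: P'_def)
    then show ?thesis using inv_subD(4)[OF K] by blast
  next
    assume Q0: "\<forall>a\<in>S. Q' a \<subseteq> {0}"
    then have "Q' a \<subseteq> {0}" using aS by blast
    then have "Q a \<subseteq> {0}" using up_self[of a] by (simp add: Q'_def)
    then have "V a \<subseteq> K" using splitsD(4)[OF s up_self] Pa by fastforce
    then have "V a = K" using inv_subD(2)[OF K] by blast
    moreover have "V b = {0}" if "b \<notin> up a" for b
    proof (cases "b \<in> S")
      case True
      then have "Q' b \<subseteq> {0}" using Q0 by blast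
      then show ?thesis using that subspace_0[OF subspace_V, of b] by (auto simp: Q'_def)
    qed (rule V_notin)
    ultimately show ?thesis by blast
  qed
qed

lemma line_inv_sub:
  assumes "e \<in> V a"
  shows "inv_sub a (span {e, D e})"
proof -
  have "span {e, D e} \<subseteq> V a"
    using assms D_V by (intro span_minimal subspace_V) auto
  moreover have "D v \<in> span {e, D e}" if "v \<in> span {e, D e}" for v
  proof -
    have "D ` span {e, D e} = span {D e, D (D e)}"
      using linear_span_image[OF linD, of "{e, D e}"] by simp
    also have "\<dots> \<subseteq> span {e, D e}"
      using DD_V[OF assms]
      by (intro span_minimal subspace_span) (auto intro: span_base span_scale span_neg)
    finally show ?thesis using that by blast
  qed
  ultimately show ?thesis by (simp add: inv_sub_def)
qed

text \<open>There is nothing below \<alpha>, so any line in \<open>V \<alpha>\<close> is orthogonal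
  to the preceding piece and must exhaust \<open>V \<alpha>\<close>. The same alternative confines
  all coefficients to \<alpha> + i.\<close>

lemma V_bottom:
  assumes "e \<in> V \<alpha>" "e \<noteq> 0"
  shows "V \<alpha> = span {e, D e}" and "b \<notin> up \<alpha> \<Longrightarrow> V b = {0}"
proof -
  have "\<alpha> - 1 \<notin> S" using \<alpha>_min[of "\<alpha> - 1"] by auto
  then have 0: "br u v = 0" if "u \<in> V (\<alpha> - 1)" for u v
    using that V_notin by (auto simp: br_linear_simps)
  have "e \<in> span {e, D e}" by (rule span_base) simp
  then have "span {e, D e} \<noteq> {0}" using assms(2) by blast
  then show "V \<alpha> = span {e, D e}" and "b \<notin> up \<alpha> \<Longrightarrow> V b = {0}"
    using orthogonal_subspace_cases[OF line_inv_sub[OF assms(1)] 0] by auto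
qed

text \<open>The right radical of the form on \<open>V a\<close> and \<open>V (a + 1)\<close> is a
  candidate for \<open>orthogonal_subspace_cases\<close>. Were it nonzero, all pieces below a + 1
  would vanish, among them \<open>V \<alpha>\<close>.\<close>

lemma right_nondegenerate:
  assumes a: "a \<in> up \<alpha>" and v: "v \<in> V (a + 1)" and orth: "\<And>u. u \<in> V a \<Longrightarrow> br u v = 0"
  shows "v = 0"
proof -
  define K where "K = {v \<in> V (a + 1). \<forall>u\<in>V a. br u v = 0}"
  have "inv_sub (a + 1) K"
    unfolding inv_sub_def
    using subspace_V[of "a + 1"] D_V br_shift(2)
    by (auto simp: K_def subspace_def br_linear_simps linear_0[OF linD])
  then have "K = {0} \<or> (V (a + 1) = K \<and> (\<forall>b. b \<notin> up (a + 1) \<longrightarrow> V b = {0}))"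
    by (rule orthogonal_subspace_cases) (auto simp: K_def)
  moreover have "\<alpha> \<notin> up (a + 1)" using up_ge[OF a] up_ge[of \<alpha> "a + 1"] by auto
  then have "\<not> (\<forall>b. b \<notin> up (a + 1) \<longrightarrow> V b = {0})" using V_nz[OF \<alpha>_mem] by blast
  ultimately have "K = {0}" by blast
  moreover have "v \<in> K" using v orth by (simp add: K_def)
  ultimately show ?thesis by blast
qed

text \<open>Since \<open>V a\<close> is the line through e, bracketing with e embeds
  \<open>V (a + 1)\<close> into the centre, a complex line. A nonzero w therefore spans, and it can
  be rescaled to hit x.\<close>

lemma chain_step:
  assumes a: "a \<in> up \<alpha>" "a \<in> S" "a + 1 \<in> S" and e: "e \<in> V a" "V a = span {e, D e}"
  shows "\<exists>e'\<in>V (a + 1). V (a + 1) = span {e', D e'} \<and> br e e' = x"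
proof -
  have a0: "a + 1 \<noteq> 0" using S_gt[OF a(3)] by auto
  have ker: "v = 0" if v: "v \<in> V (a + 1)" and 0: "br e v = 0" for v
  proof (rule right_nondegenerate[OF a(1) v])
    fix u assume "u \<in> V a"
    moreover have "subspace {u. br u v = 0}"
      by (auto simp: subspace_def br_linear_simps)
    moreover have "br (D e) v = 0" using br_shift(1)[OF e(1) v] 0 by (simp add: linear_0[OF linD])
    ultimately show "br u v = 0"
      using e(2) 0 span_minimal[of "{e, D e}" "{u. br u v = 0}"] by auto
  qed
  obtain w where w: "w \<in> V (a + 1)" "w \<noteq> 0" using V_nz[OF a(3)] by blast
  obtain s t where st: "br e w = s *\<^sub>R x + t *\<^sub>R y" using span_xy_E[OF br_mem] by blast
  define N where "N = s\<^sup>2 + t\<^sup>2"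
  have N: "N \<noteq> 0"
  proof
    assume "N = 0"
    then have "br e w = 0" by (simp add: N_def st sum_power2_eq_zero_iff)
    then show False using ker w by blast
  qed
  \<comment> \<open>With i acting as D, s x + t y is (s - t i) x. So w is multiplied by the inverse
    (s + t i) / N, where i acts on \<open>V (a + 1)\<close> as D / (a + 1).\<close>
  define e' where "e' = (s / N) *\<^sub>R w + (t / (N * (a + 1))) *\<^sub>R D w"
  have e': "e' \<in> V (a + 1)"
    unfolding e'_def using w(1) D_V by (intro subspace_add subspace_scale subspace_V) auto
  have "br e e' = (s / N) *\<^sub>R br e w + (t / N) *\<^sub>R D (br e w)"
    using a0 by (simp add: e'_def br_linear_simps br_shift(2)[OF e(1) w(1)])
  also have "\<dots> = (s / N * s + t / N * t) *\<^sub>R x"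
    by (simp add: st D_linear_simps Dx Dy algebra_simps)
  also have "s / N * s + t / N * t = 1"
    using N by (simp add: N_def power2_eq_square flip: add_divide_distrib)
  finally have brx: "br e e' = x" by simp
  have "v \<in> span {e', D e'}" if v: "v \<in> V (a + 1)" for v
  proof -
    obtain s t where st: "br e v = s *\<^sub>R x + t *\<^sub>R y" using span_xy_E[OF br_mem] by blast
    \<comment> \<open>The multiple (s - t i) e', which has the same bracket with e as v.\<close>
    let ?v = "s *\<^sub>R e' - (t / (a + 1)) *\<^sub>R D e'"
    have "br e (v - ?v) = 0"
      using a0 by (simp add: br_linear_simps br_shift(2)[OF e(1) e'] brx st Dx)
    moreover have "v - ?v \<in> V (a + 1)"
      using v e' D_V by (intro subspace_diff subspace_scale subspace_V) auto
    ultimately have "v = ?v" using ker by fastforce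
    moreover have "?v \<in> span {e', D e'}"
      by (intro span_diff span_scale span_base) auto
    ultimately show ?thesis by simp
  qed
  then show ?thesis
    using e' brx inv_subD(2)[OF line_inv_sub[OF e']] by (intro bexI[of _ e']) auto
qed

lemma S_pred:
  assumes "a \<in> up \<alpha>" "a + 1 \<in> S"
  shows "a \<in> S"
proof (rule ccontr)
  assume "a \<notin> S"
  then have "br u v = 0" if "u \<in> V a" for u v using that V_notin by (auto simp: br_linear_simps)
  then show False using right_nondegenerate[OF assms(1)] V_nz[OF assms(2)] by blast
qed

lemma chain_exists:
  obtains l :: nat and e :: "nat \<Rightarrow> 'a"
  where "\<And>k. k \<le> l \<Longrightarrow> \<alpha> + real k \<in> S \<and> e k \<in> V (\<alpha> + real k) \<and> V (\<alpha> + real k) = span {e k, D (e k)}"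
    and "\<And>k. k < l \<Longrightarrow> br (e k) (e (Suc k)) = x"
    and "S = (\<lambda>k. \<alpha> + real k) ` {..l}"
proof -
  define I where "I = {k. \<alpha> + real k \<in> S}"
  have "finite I"
    unfolding I_def by (rule finite_vimageI[OF finS, unfolded vimage_def]) (auto simp: inj_on_def)
  have "0 \<in> I" using \<alpha>_mem by (simp add: I_def)
  define l where "l = Max I"
  have lI: "l \<in> I" unfolding l_def using \<open>0 \<in> I\<close> by (intro Max_in[OF \<open>finite I\<close>]) auto
  \<comment> \<open>Descending from the largest index, \<open>S_pred\<close> shows that there are no
    gaps.\<close>
  have mem: "\<alpha> + real k \<in> S" if "k \<le> l" for k
    using that
  proof (induction rule: inc_induct)
    case base
    then show ?case using lI by (simp add: I_def)
  next
    case (step k)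
    have "\<alpha> + real k \<in> up \<alpha>" by (auto simp: up_def)
    then show ?case using S_pred[of "\<alpha> + real k"] step by (simp add: add_ac)
  qed
  obtain e0 where e0: "e0 \<in> V \<alpha>" "e0 \<noteq> 0" using V_nz[OF \<alpha>_mem] by blast
  have "S \<subseteq> up \<alpha>" using V_bottom(2)[OF e0] V_nz by blast
  moreover have "k \<le> l" if "\<alpha> + real k \<in> S" for k
    using that \<open>finite I\<close> by (simp add: l_def I_def)
  ultimately have S: "S = (\<lambda>k. \<alpha> + real k) ` {..l}" using mem by (auto simp: up_def)
  \<comment> \<open>Dependent choice yields an infinite sequence; the guards leave the terms beyond
    l arbitrary.\<close>
  have "\<exists>e. \<forall>k. (k \<le> l \<longrightarrow> e k \<in> V (\<alpha> + real k) \<and> V (\<alpha> + real k) = span {e k, D (e k)}) \<and>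
      (Suc k \<le> l \<longrightarrow> br (e k) (e (Suc k)) = x)"
  proof (rule dependent_nat_choice)
    show "\<exists>e. 0 \<le> l \<longrightarrow> e \<in> V (\<alpha> + real 0) \<and> V (\<alpha> + real 0) = span {e, D e}"
      using e0 V_bottom(1)[OF e0] by auto
    fix e k assume e: "k \<le> l \<longrightarrow> e \<in> V (\<alpha> + real k) \<and> V (\<alpha> + real k) = span {e, D e}"
    show "\<exists>e'. (Suc k \<le> l \<longrightarrow> e' \<in> V (\<alpha> + real (Suc k)) \<and> V (\<alpha> + real (Suc k)) = span {e', D e'}) \<and>
        (Suc k \<le> l \<longrightarrow> br e e' = x)"
    proof (cases "Suc k \<le> l")
      case True
      have "\<alpha> + real k \<in> up \<alpha>" by (auto simp: up_def)
      then show ?thesis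
        using chain_step[of "\<alpha> + real k" e] e True mem[of k] mem[OF True] by (auto simp: add_ac)
    qed simp
  qed
  then show ?thesis using that[of l] mem S by (metis Suc_le_eq)
qed

lemma pr_V: "v \<in> V b \<Longrightarrow> pr a v = (if a = b then v else 0)"
  by (metis mem_V pr_pr)

text \<open>On \<open>V a\<close> the square of D is a negative scalar, so D has no real eigenvector
  there.\<close>

lemma eigenline_independent:
  assumes "a \<in> S" "e \<in> V a" "e \<noteq> 0"
  shows "D e \<noteq> c *\<^sub>R e"
proof
  assume 1: "D e = c *\<^sub>R e"
  then have "D (D e) = (c * c) *\<^sub>R e" by (simp add: D_linear_simps)
  then have "(c * c) *\<^sub>R e = - (a\<^sup>2) *\<^sub>R e" by (simp only: DD_V[OF assms(2)])
  then have "(c * c + a\<^sup>2) *\<^sub>R e = 0" by (simp add: scaleR_add_left)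
  then have "c * c + a * a = 0" using assms(3) by (simp add: power2_eq_square)
  then show False using S_gt[OF assms(1)] by (simp add: add_nonneg_eq_0_iff)
qed

theorem normal_form_basis:
  obtains l :: nat and e f :: "nat \<Rightarrow> 'a"
  where "ordered_basis (concat (map (\<lambda>k. [e k, f k]) [0..<Suc l]) @ [x, y])"
    and "\<And>k. k \<le> l \<Longrightarrow> D (e k) = - (\<alpha> + real k) *\<^sub>R f k"
    and "\<And>k. k \<le> l \<Longrightarrow> D (f k) = (\<alpha> + real k) *\<^sub>R e k"
    and "\<And>k. k < l \<Longrightarrow> br (e k) (e (Suc k)) = x \<and> br (e k) (f (Suc k)) = y \<and>
           br (f k) (e (Suc k)) = - y \<and> br (f k) (f (Suc k)) = x"
    and "\<And>j k u v. j \<le> l \<Longrightarrow> k \<le> l \<Longrightarrow> j \<noteq> Suc k \<Longrightarrow> k \<noteq> Suc j \<Longrightarrow>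
           u \<in> {e j, f j} \<Longrightarrow> v \<in> {e k, f k} \<Longrightarrow> br u v = 0"
proof -
  obtain l :: nat and e :: "nat \<Rightarrow> 'a"
    where e: "\<And>k. k \<le> l \<Longrightarrow> \<alpha> + real k \<in> S \<and> e k \<in> V (\<alpha> + real k) \<and> V (\<alpha> + real k) = span {e k, D (e k)}"
      and ee: "\<And>k. k < l \<Longrightarrow> br (e k) (e (Suc k)) = x"
      and S: "S = (\<lambda>k. \<alpha> + real k) ` {..l}"
    using chain_exists by blast
  \<comment> \<open>This f k is - i times e k. It makes the matrix of D on the plane equal to
    (\<alpha> + k) J, and sesquilinearity then derives all four brackets of neighbouring planes from
    the single normalisation in \<open>ee\<close>.\<close>
  define f where "f k = - (1 / (\<alpha> + real k)) *\<^sub>R D (e k)" for k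
  have pos: "\<alpha> + real k > 0" for k using S_gt[OF \<alpha>_mem] by simp
  then have nz: "\<alpha> + real k \<noteq> 0" for k by (metis less_irrefl)
  have eV: "e k \<in> V (\<alpha> + real k)" if "k \<le> l" for k using e that by blast
  have fV: "f k \<in> V (\<alpha> + real k)" if "k \<le> l" for k
    unfolding f_def by (intro subspace_scale subspace_V D_V eV that)
  have De: "D (e k) = - (\<alpha> + real k) *\<^sub>R f k" for k
  proof -
    have "D w = - c *\<^sub>R (- (1 / c) *\<^sub>R D w)" if "c \<noteq> 0" for c w using that by simp
    from this[OF nz[of k]] show ?thesis unfolding f_def .
  qed
  have Df: "D (f k) = (\<alpha> + real k) *\<^sub>R e k" if "k \<le> l" for k
    using nz[of k] by (simp add: f_def D_linear_simps DD_V[OF eV[OF that]] power2_eq_square)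
  have e0: "e k \<noteq> 0" if "k \<le> l" for k
    using e[OF that] V_nz[of "\<alpha> + real k"] by (auto simp: linear_0[OF linD])
  have step: "br (e k) (e (Suc k)) = x \<and> br (e k) (f (Suc k)) = y \<and>
           br (f k) (e (Suc k)) = - y \<and> br (f k) (f (Suc k)) = x" if "k < l" for k
  proof -
    have Ve: "e (Suc k) \<in> V (\<alpha> + real k + 1)" using eV[of "Suc k"] that by (simp add: add_ac)
    have k: "k \<le> l" using that by simp
    have n1: "\<alpha> + real k + 1 \<noteq> 0" using nz[of "Suc k"] by (simp add: add_ac)
    have fS: "f (Suc k) = - (1 / (\<alpha> + real k + 1)) *\<^sub>R D (e (Suc k))"
      by (simp add: f_def add_ac)
    have 1: "br (f k) (e (Suc k)) = - y"
    proof -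
      obtain a where a: "a = \<alpha> + real k" by simp
      have "br (D (e k)) (e (Suc k)) = a *\<^sub>R y"
        using br_shift(1)[OF eV[OF k] Ve] ee[OF that] by (simp add: Dx del: minus_add_distrib flip: a)
      then show ?thesis using nz[of k] by (simp add: f_def br_linear_simps flip: a)
    qed
    have "br u (f (Suc k)) = - D (br u (e (Suc k)))" if "u \<in> V (\<alpha> + real k)" for u
      unfolding fS using n1 by (simp add: br_linear_simps br_shift(2)[OF that Ve])
    then show ?thesis using eV[OF k] fV[OF k] 1 ee[OF that] by (simp add: Dx Dy D_linear_simps)
  qed
  have zero: "br u v = 0" if "j \<le> l" "k \<le> l" "j \<noteq> Suc k" "k \<noteq> Suc j" "u \<in> {e j, f j}" "v \<in> {e k, f k}"
    for j k u v
  proof -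
    have "u \<in> V (\<alpha> + real j)" "v \<in> V (\<alpha> + real k)" using that eV fV by blast+
    moreover have "real k \<noteq> real j + 1" "real j \<noteq> real k + 1" using that(3,4) by linarith+
    ultimately show ?thesis using br_V_cases[of u "\<alpha> + real j" v "\<alpha> + real k"] by auto
  qed
  let ?b = "\<lambda>m. concat (map (\<lambda>k. [e k, f k]) [0..<m])"
  have indep_b: "distinct (?b m @ [x, y]) \<and> independent (set (?b m @ [x, y]))" if "m \<le> Suc l" for m
    using that
  proof (induction m)
    case 0
    then show ?case using indep xy by simp
  next
    case (Suc m)
    then have m: "m \<le> l" by simp
    let ?B = "set (?b m @ [x, y])"
    let ?a = "\<alpha> + real m"
    \<comment> \<open>The projection of degree \<alpha> + m kills all vectors listed so far and
      fixes the two new ones.\<close>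
    have "?B \<subseteq> {v. pr ?a v = 0}"
    proof
      fix v assume "v \<in> ?B"
      then consider "v \<in> {x, y}" | k where "k < m" "v \<in> {e k, f k}" by auto
      then have "pr ?a v = 0"
      proof cases
        case 1
        then show ?thesis by (intro pr_Z span_base)
      next
        case (2 k)
        then have "v \<in> V (\<alpha> + real k)" using eV[of k] fV[of k] m by auto
        then show ?thesis using pr_V \<open>k < m\<close> by simp
      qed
      then show "v \<in> {v. pr ?a v = 0}" by simp
    qed
    then have sp: "pr ?a v = 0" if "v \<in> span ?B" for v
      using span_minimal[OF _ linear_subspace_kernel[OF linpr], of ?B ?a] that by auto
    have pe: "pr ?a (e m) = e m" and pf: "pr ?a (f m) = f m" using pr_V eV[OF m] fV[OF m] by auto
    have e_notin: "e m \<notin> span ?B" using sp pe e0[OF m] by auto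
    have f_notin: "f m \<notin> span (insert (e m) ?B)"
    proof
      assume "f m \<in> span (insert (e m) ?B)"
      then obtain c where "f m - c *\<^sub>R e m \<in> span ?B" unfolding span_breakdown_eq by blast
      then have "f m = c *\<^sub>R e m"
        using sp pe pf by (force simp: linear_diff[OF linpr] linear_scale[OF linpr])
      then have "D (e m) = (- ?a * c) *\<^sub>R e m" by (simp add: De)
      then show False using eigenline_independent[of ?a "e m"] e[OF m] e0[OF m] by blast
    qed
    have eq: "set (?b (Suc m) @ [x, y]) = insert (f m) (insert (e m) ?B)" by auto
    have IH: "distinct (?b m @ [x, y])" "independent ?B" using Suc by simp_all
    have "independent (insert (f m) (insert (e m) ?B))"
      by (intro independent_insertI f_notin e_notin IH)
    moreover have "e m \<notin> ?B" "f m \<notin> insert (e m) ?B" using e_notin f_notin span_base by blast+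
    then have "distinct (?b (Suc m) @ [x, y])" using IH(1) by auto
    ultimately show ?case unfolding eq by blast
  qed
  have "v \<in> span (set (?b (Suc l) @ [x, y]))" for v
  proof -
    let ?B = "set (?b (Suc l) @ [x, y])"
    have "V a \<subseteq> span ?B" if "a \<in> S" for a
    proof -
      obtain k where k: "k \<le> l" "a = \<alpha> + real k" using S \<open>a \<in> S\<close> by auto
      then have "k \<in> set [0..<Suc l]" by auto
      then have "e k \<in> ?B" "f k \<in> ?B" by (auto simp del: upt_Suc)
      then have "e k \<in> span ?B" "f k \<in> span ?B" by (auto intro: span_base)
      then have "D (e k) \<in> span ?B" unfolding De by (intro span_scale)
      then have "span {e k, D (e k)} \<subseteq> span ?B"
        using \<open>e k \<in> span ?B\<close> by (intro span_minimal subspace_span) auto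
      then show ?thesis using e[OF k(1)] k(2) by simp
    qed
    then have "(\<Sum>a\<in>S. pr a v) \<in> span ?B"
      by (intro span_sum) (auto simp: V_def)
    moreover have "v - (\<Sum>a\<in>S. pr a v) \<in> span ?B"
      using pr_sum span_mono[of "{x, y}" ?B] by auto
    ultimately have "(v - (\<Sum>a\<in>S. pr a v)) + (\<Sum>a\<in>S. pr a v) \<in> span ?B" by (intro span_add)
    then show ?thesis by simp
  qed
  then have "ordered_basis (?b (Suc l) @ [x, y])"
    using indep_b[of "Suc l"] unfolding ordered_basis_def by blast
  then show ?thesis using that De Df step zero by blast
qed

end

subsection \<open>Exponentials and one-parameter subgroups of the circle\<close>

lemma linear_funpow:
  fixes D :: "'a::real_vector \<Rightarrow> 'a"
  assumes "linear D"
  shows "linear (D ^^ k)"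
proof (induction k)
  case 0
  show ?case by (simp add: linearI)
next
  case (Suc k)
  show ?case using linear_compose[OF Suc assms] unfolding funpow.simps .
qed

lemma lin_exp_sums:
  fixes D :: "'a::euclidean_space \<Rightarrow> 'a"
  assumes "linear D"
  shows "(\<lambda>k. (D ^^ k) v /\<^sub>R fact k) sums lin_exp D v"
proof -
  obtain B where B: "B > 0" "\<And>v. norm (D v) \<le> B * norm v"
    using linear_bounded_pos[OF assms] by blast
  have le: "norm ((D ^^ k) v) \<le> B ^ k * norm v" for k
  proof (induction k)
    case (Suc k)
    have "norm ((D ^^ Suc k) v) \<le> B * norm ((D ^^ k) v)" using B(2) by simp
    also have "\<dots> \<le> B * (B ^ k * norm v)" using Suc B(1) by simp
    finally show ?case by (simp add: mult_ac)
  qed simp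
  have "summable (\<lambda>k. inverse (fact k) * B ^ k * norm v)"
    by (intro summable_mult2 summable_exp)
  moreover have "norm ((D ^^ k) v /\<^sub>R fact k) \<le> inverse (fact k) * B ^ k * norm v" for k
  proof -
    have "inverse (fact k) * norm ((D ^^ k) v) \<le> inverse (fact k) * (B ^ k * norm v)"
      by (rule mult_left_mono[OF le]) simp
    then show ?thesis by (simp only: norm_scaleR mult.assoc) simp
  qed
  ultimately have "summable (\<lambda>k. (D ^^ k) v /\<^sub>R fact k)"
    by (rule summable_comparison_test')
  then show ?thesis unfolding lin_exp_def by (rule summable_sums)
qed

lemma linear_lin_exp:
  fixes D :: "'a::euclidean_space \<Rightarrow> 'a"
  assumes "linear D"
  shows "linear (lin_exp D)"
proof (rule linearI)
  note lin = linear_funpow[OF assms]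
  fix u v :: 'a and c :: real
  have "(\<lambda>k. (D ^^ k) (u + v) /\<^sub>R fact k) sums (lin_exp D u + lin_exp D v)"
    using sums_add[OF lin_exp_sums[OF assms, of u] lin_exp_sums[OF assms, of v]]
    by (simp add: linear_add[OF lin] scaleR_add_right)
  then show "lin_exp D (u + v) = lin_exp D u + lin_exp D v"
    using lin_exp_sums[OF assms] sums_unique2 by blast
  have "(\<lambda>k. (D ^^ k) (c *\<^sub>R u) /\<^sub>R fact k) sums (c *\<^sub>R lin_exp D u)"
    using sums_scaleR_right[OF lin_exp_sums[OF assms, of u], of c]
    by (simp add: linear_scale[OF lin] mult.commute)
  then show "lin_exp D (c *\<^sub>R u) = c *\<^sub>R lin_exp D u"
    using lin_exp_sums[OF assms] sums_unique2 by blast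
qed

text \<open>The partial sums stay in \<open>W\<close>, and subspaces are closed in finite dimension.
  This is how D-invariant subspaces become T-invariant.\<close>

lemma lin_exp_mem_subspace:
  fixes D :: "'a::euclidean_space \<Rightarrow> 'a"
  assumes D: "linear D" and W: "subspace W" "\<And>v. v \<in> W \<Longrightarrow> D v \<in> W" and v: "v \<in> W"
  shows "lin_exp D v \<in> W"
proof -
  have "(D ^^ k) v \<in> W" for k by (induction k) (use W(2) v in auto)
  then have "(\<Sum>k<n. (D ^^ k) v /\<^sub>R fact k) \<in> W" for n
    by (intro subspace_sum subspace_scale W(1))
  then show ?thesis
    using lin_exp_sums[OF D, of v] closed_sequentially[OF closed_subspace[OF W(1)],
      of "\<lambda>n. \<Sum>k<n. (D ^^ k) v /\<^sub>R fact k"]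
    by (simp add: sums_def)
qed

text \<open>The map \<open>L\<close> sends 1 to u and - \<i> to w and intertwines multiplication by
  \<i> c with D. It thus carries the complex exponential series to that of D.\<close>

lemma lin_exp_rotation:
  fixes D :: "'a::euclidean_space \<Rightarrow> 'a"
  assumes D: "linear D" and u: "D u = - c *\<^sub>R w" and w: "D w = c *\<^sub>R u"
  shows "lin_exp D u = cos c *\<^sub>R u - sin c *\<^sub>R w" and "lin_exp D w = sin c *\<^sub>R u + cos c *\<^sub>R w"
proof -
  define L where "L z = Re z *\<^sub>R u - Im z *\<^sub>R w" for z
  have L: "bounded_linear L"
    unfolding L_def by (intro bounded_linear_sub bounded_linear_scaleR_const bounded_linear_Re bounded_linear_Im)
  have DL: "D (L z) = L (\<i> * of_real c * z)" for z
    by (simp add: L_def linear_diff[OF D] linear_scale[OF D] u w algebra_simps)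
  have pow: "(D ^^ k) (L z) = L ((\<i> * of_real c) ^ k * z)" for k z
    by (induction k) (simp_all add: DL mult_ac)
  have "lin_exp D (L z) = L (cis c * z)" for z
  proof -
    have "(\<lambda>k. (\<i> * of_real c) ^ k /\<^sub>R fact k * z) sums (exp (\<i> * of_real c) * z)"
      by (intro sums_mult2 exp_converges)
    from bounded_linear.sums[OF L this]
    have "(\<lambda>k. (D ^^ k) (L z) /\<^sub>R fact k) sums L (cis c * z)"
      by (simp add: pow cis_conv_exp linear_scale[OF bounded_linear.linear[OF L]])
    then show ?thesis using lin_exp_sums[OF D] sums_unique2 by blast
  qed
  from this[of 1] this[of "- \<i>"] show "lin_exp D u = cos c *\<^sub>R u - sin c *\<^sub>R w"
    and "lin_exp D w = sin c *\<^sub>R u + cos c *\<^sub>R w"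
    by (simp_all add: L_def)
qed

text \<open>Each b of the spanning set has a companion w that D exchanges with it up to scalars. So
  \<open>E s\<close> is given by sines and cosines, and the group law, continuity and derivative are
  checked on \<open>B\<close> by trigonometry.\<close>

locale rotational =
  fixes D :: "'a::euclidean_space \<Rightarrow> 'a" and B :: "'a set"
  assumes lin: "linear D" and span: "span B = UNIV"
    and rot: "b \<in> B \<Longrightarrow> \<exists>c w. D b = - c *\<^sub>R w \<and> D w = c *\<^sub>R b"
begin

abbreviation E :: "real \<Rightarrow> 'a \<Rightarrow> 'a" where "E s \<equiv> lin_exp (\<lambda>v. s *\<^sub>R D v)"

lemma linear_scaleD: "linear (\<lambda>v. s *\<^sub>R D v)"
  by (intro linear_compose_scale_right lin)

lemma linear_E: "linear (E s)"
  by (intro linear_lin_exp linear_scaleD)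

lemma E_rotation:
  assumes "D u = - c *\<^sub>R w" "D w = c *\<^sub>R u"
  shows "E s u = cos (s * c) *\<^sub>R u - sin (s * c) *\<^sub>R w" and "E s w = sin (s * c) *\<^sub>R u + cos (s * c) *\<^sub>R w"
  using lin_exp_rotation[OF linear_scaleD, of s u "s * c" w] assms by simp_all

lemma E_add: "E (s + t) = E s \<circ> E t"
proof
  fix v
  have "E (s + t) b = (E s \<circ> E t) b" if "b \<in> B" for b
  proof -
    obtain c w where c: "D b = - c *\<^sub>R w" "D w = c *\<^sub>R b" using rot[OF \<open>b \<in> B\<close>] by blast
    show ?thesis
      unfolding comp_apply E_rotation[OF c] linear_diff[OF linear_E] linear_scale[OF linear_E]
        distrib_right cos_add sin_add
      by (simp add: algebra_simps)
  qed
  then show "E (s + t) v = (E s \<circ> E t) v"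
    using linear_eq_on[OF linear_E linear_compose[OF linear_E linear_E], of v B] span by simp
qed

lemma E_derivative: "((\<lambda>s. E s v) has_vector_derivative D v) (at 0)"
proof -
  have "v \<in> span B" using span by simp
  then show ?thesis
  proof (induction rule: span_induct_alt)
    case base
    show ?case by (simp add: linear_0[OF linear_E] linear_0[OF lin])
  next
    case (step c b v)
    obtain d w where d: "D b = - d *\<^sub>R w" "D w = d *\<^sub>R b" using rot[OF step(1)] by blast
    have "((\<lambda>s. cos (s * d) *\<^sub>R b - sin (s * d) *\<^sub>R w) has_vector_derivative - d *\<^sub>R w) (at 0)"
      by (auto intro!: derivative_eq_intros simp: has_real_derivative_iff_has_vector_derivative[symmetric])
    then have "((\<lambda>s. E s b) has_vector_derivative D b) (at 0)"
      unfolding E_rotation[OF d] d(1) .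
    from has_vector_derivative_add[OF bounded_linear.has_vector_derivative[OF bounded_linear_scaleR_right this, of c] step(2)]
    show ?case by (simp add: linear_add[OF linear_E] linear_scale[OF linear_E] linear_add[OF lin] linear_scale[OF lin])
  qed
qed

lemma E_continuous: "continuous_on X (\<lambda>s. E s v)"
proof -
  have "v \<in> span B" using span by simp
  then show ?thesis
  proof (induction rule: span_induct_alt)
    case base
    show ?case by (simp add: linear_0[OF linear_E])
  next
    case (step c b v)
    obtain d w where d: "D b = - d *\<^sub>R w" "D w = d *\<^sub>R b" using rot[OF step(1)] by blast
    show ?case
      unfolding linear_add[OF linear_E] linear_scale[OF linear_E] E_rotation[OF d]
      by (intro continuous_intros step)
  qed
qed

text \<open>Both sides of \<open>aut\<close> are differentiated at s = 0, the right one by the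
  product rule for a bounded bilinear map.\<close>

lemma derivation_if_automorphisms:
  assumes bil: "bilinear br" and aut: "\<And>s u v. E s (br u v) = br (E s u) (E s v)"
  shows "D (br u v) = br (D u) v + br u (D v)"
proof -
  have bb: "bounded_bilinear br" using bil bilinear_conv_bounded_bilinear by blast
  have E0: "E 0 v = v" for v
  proof -
    have "linear (\<lambda>v::'a. v)" by (rule linear_id[unfolded id_def])
    moreover have "E 0 b = b" if b: "b \<in> B" for b
    proof -
      obtain d w where d: "D b = - d *\<^sub>R w" "D w = d *\<^sub>R b" using rot[OF b] by blast
      show ?thesis using E_rotation(1)[OF d, of 0] by simp
    qed
    ultimately show ?thesis using linear_eq_on[OF linear_E, of "\<lambda>v. v" v B 0] span by simp
  qed
  have "((\<lambda>s. br (E s u) (E s v)) has_vector_derivative br (E 0 u) (D v) + br (D u) (E 0 v)) (at 0)"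
    by (intro bounded_bilinear.has_vector_derivative[OF bb] E_derivative)
  then have "((\<lambda>s. E s (br u v)) has_vector_derivative br u (D v) + br (D u) v) (at 0)"
    by (simp only: aut E0)
  from vector_derivative_unique_at[OF E_derivative this] show ?thesis by (simp add: add.commute)
qed

end

section \<open>Recognising T as a one-parameter group\<close>

lemma circle_hom_surj:
  fixes \<psi> :: "real \<Rightarrow> complex"
  assumes cont: "continuous_on UNIV \<psi>" and norm: "\<And>s. norm (\<psi> s) = 1"
    and hom: "\<And>s t. \<psi> (s + t) = \<psi> s * \<psi> t" and s0: "\<psi> s0 \<noteq> 1" and z: "norm z = 1"
  shows "z \<in> range \<psi>"
proof -
  have nz: "\<psi> s \<noteq> 0" for s using norm[of s] by auto
  have \<psi>0: "\<psi> 0 = 1" using hom[of 0 0] nz[of 0] by simp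
  have sq: "(Re (\<psi> s))\<^sup>2 + (Im (\<psi> s))\<^sup>2 = 1" for s
    using norm[of s] cmod_power2[of "\<psi> s"] by simp
  have lt: "Re (\<psi> s0) < 1"
  proof -
    have "Re (\<psi> s0) \<le> 1" using complex_Re_le_cmod[of "\<psi> s0"] norm by simp
    moreover have "Re (\<psi> s0) \<noteq> 1" using sq[of s0] s0 by (auto simp: complex_eq_iff)
    ultimately show ?thesis by simp
  qed
  \<comment> \<open>Connectedness of the line makes Re \<psi> attain every value between Re (\<psi>
    s0) and 1. This determines \<psi> s up to conjugation, and conjugation is inversion on the
    circle. So the image contains an arc around 1.\<close>
  have small: "cis \<theta> \<in> range \<psi>" if \<theta>: "cos \<theta> \<ge> Re (\<psi> s0)" for \<theta>
  proof -
    have "connected (range (\<lambda>s. Re (\<psi> s)))"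
      by (intro connected_continuous_image continuous_intros cont connected_UNIV)
    moreover have "Re (\<psi> s0) \<in> range (\<lambda>s. Re (\<psi> s))" "1 \<in> range (\<lambda>s. Re (\<psi> s))"
      using \<psi>0 by (auto intro: rev_image_eqI[of 0])
    ultimately have "cos \<theta> \<in> range (\<lambda>s. Re (\<psi> s))"
      using \<theta> cos_le_one[of \<theta>] by (blast intro: connectedD_interval)
    then obtain s where s: "Re (\<psi> s) = cos \<theta>" by auto
    then have "(Im (\<psi> s))\<^sup>2 = (sin \<theta>)\<^sup>2" 
      using sq[of s] sin_cos_squared_add[of \<theta>] by (simp only: s)
    then consider "Im (\<psi> s) = sin \<theta>" | "Im (\<psi> s) = - sin \<theta>" by (auto simp: power2_eq_iff)
    then show ?thesis
    proof cases
      case 1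
      then have "\<psi> s = cis \<theta>" using s by (simp add: complex_eq_iff)
      then show ?thesis by (metis rangeI)
    next
      case 2
      then have "\<psi> s = cis (- \<theta>)" using s by (simp add: complex_eq_iff)
      then have "cis (- \<theta>) * \<psi> (- s) = cis (- \<theta>) * cis \<theta>"
        using hom[of s "- s"] \<psi>0 by (simp add: cis_mult)
      then have "\<psi> (- s) = cis \<theta>" by simp
      then show ?thesis by (metis rangeI)
    qed
  qed
  obtain t where t: "z = cis t" using z by (metis cis_Arg_unique complex_norm_eq_1_exp cis_conv_exp)
  \<comment> \<open>An arc around 1 contains an n-th root of z for large n, and the image is closed
    under powers.\<close>
  have "(\<lambda>n. cos (t / real (Suc n))) \<longlonglongrightarrow> cos 0"
    by (intro tendsto_cos LIMSEQ_Suc lim_const_over_n)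
  then have "\<forall>\<^sub>F n in sequentially. Re (\<psi> s0) < cos (t / real (Suc n))"
    using lt by (intro order_tendstoD(1)) auto
  then obtain n where n: "Re (\<psi> s0) < cos (t / real (Suc n))"
    using eventually_happens'[OF sequentially_bot] by blast
  then obtain s where s: "\<psi> s = cis (t / real (Suc n))"
    using small[of "t / real (Suc n)"] by (auto simp del: of_nat_Suc)
  have "\<psi> (real k * s) = \<psi> s ^ k" for k
    by (induction k) (simp_all add: \<psi>0 hom distrib_right)
  then have "\<psi> (real (Suc n) * s) = cis (real (Suc n) * (t / real (Suc n)))"
    unfolding s by (simp only: Complex.DeMoivre)
  also have "\<dots> = z" using t by simp
  finally show ?thesis by (metis rangeI)
qed

lemma SO2_circle:
  assumes "SO2_automorphism_group br T"
  obtains \<eta> where "bij_betw \<eta> (sphere (0::complex) 1) T"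
    and "\<And>z w. norm z = 1 \<Longrightarrow> norm w = 1 \<Longrightarrow> \<eta> (z * w) = \<eta> z \<circ> \<eta> w"
    and "\<And>v. continuous_on (sphere 0 1) (\<lambda>z. \<eta> z v)"
proof -
  obtain \<phi> where \<phi>: "bij_betw \<phi> SO2 T" "\<And>A B. A \<in> SO2 \<Longrightarrow> B \<in> SO2 \<Longrightarrow> \<phi> (A ** B) = \<phi> A \<circ> \<phi> B"
    "\<And>v. continuous_on SO2 (\<lambda>A. \<phi> A v)"
    using assms unfolding SO2_automorphism_group_def by blast
  \<comment> \<open>The matrix of multiplication by z on the plane with basis 1, \<i>.\<close>
  define \<rho> :: "complex \<Rightarrow> real^2^2" where
    "\<rho> z = (\<chi> i j. if i = j then Re z else if i = 1 then - Im z else Im z)" for z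
  have comp: "\<rho> z $ 1 $ 1 = Re z" "\<rho> z $ 1 $ 2 = - Im z" "\<rho> z $ 2 $ 1 = Im z" "\<rho> z $ 2 $ 2 = Re z" for z
    by (simp_all add: \<rho>_def)
  have mult: "\<rho> (z * w) = \<rho> z ** \<rho> w" for z w
    by (simp add: Finite_Cartesian_Product.vec_eq_iff forall_2 comp matrix_matrix_mult_def sum_2 algebra_simps)
  have SO2: "A \<in> SO2 \<longleftrightarrow> A \<in> \<rho> ` sphere 0 1" for A
  proof
    assume "A \<in> SO2"
    then have o: "transpose A ** A = Finite_Cartesian_Product.mat 1" and d: "det A = 1"
      by (auto simp: SO2_def rotation_matrix_def orthogonal_matrix)
    define a b c e where "a = A $ 1 $ 1" and "b = A $ 1 $ 2" and "c = A $ 2 $ 1" and "e = A $ 2 $ 2"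
    have eqs: "a * a + c * c = 1" "a * b + c * e = 0" "a * e - b * c = 1"
      using o d by (auto simp: Finite_Cartesian_Product.vec_eq_iff forall_2 matrix_matrix_mult_def sum_2 transpose_def Finite_Cartesian_Product.mat_def det_2 a_def b_def c_def e_def)
    \<comment> \<open>Multiplying by the unit a a + c c expresses e and b through the determinant
      and the orthogonality relation.\<close>
    have "e = e * (a * a + c * c)" using eqs(1) by simp
    also have "\<dots> = a * (a * e - b * c) + c * (a * b + c * e)" by (simp add: algebra_simps)
    finally have "e = a" by (simp add: eqs)
    moreover have "b = b * (a * a + c * c)" using eqs(1) by simp
    then have "b = a * (a * b + c * e) - c * (a * e - b * c)" by (simp add: algebra_simps)
    then have "b = - c" by (simp add: eqs)
    ultimately have "A = \<rho> (Complex a c)"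
      by (simp add: Finite_Cartesian_Product.vec_eq_iff forall_2 comp flip: a_def b_def c_def e_def)
    moreover have "norm (Complex a c) = 1" using eqs(1) by (simp add: complex_norm power2_eq_square)
    ultimately show "A \<in> \<rho> ` sphere 0 1" by auto
  next
    assume "A \<in> \<rho> ` sphere 0 1"
    then obtain z where z: "A = \<rho> z" "norm z = 1" by auto
    then have "Re z * Re z + Im z * Im z = 1" using cmod_power2[of z] by (simp add: power2_eq_square)
    then show "A \<in> SO2"
      by (simp add: SO2_def rotation_matrix_def orthogonal_matrix z Finite_Cartesian_Product.vec_eq_iff forall_2 comp det_2
          matrix_matrix_mult_def sum_2 transpose_def Finite_Cartesian_Product.mat_def algebra_simps)
  qed
  have inj: "inj_on \<rho> (sphere 0 1)"
  proof (rule inj_onI)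
    fix z w assume "\<rho> z = \<rho> w"
    then show "z = w" using comp(1,3) by (metis complex_eq_iff)
  qed
  have bij: "bij_betw \<rho> (sphere 0 1) SO2"
    using inj SO2 by (auto simp: bij_betw_def)
  have cont: "continuous_on X \<rho>" for X
    unfolding \<rho>_def
  proof (intro continuous_on_vec_lambda)
    fix i j :: 2
    show "continuous_on X (\<lambda>z. if i = j then Re z else if i = 1 then - Im z else Im z)"
      by (cases "i = j"; cases "i = 1") (auto intro!: continuous_intros)
  qed
  show ?thesis
  proof
    show "bij_betw (\<phi> \<circ> \<rho>) (sphere 0 1) T"
      by (rule bij_betw_trans[OF bij \<phi>(1)])
    show "(\<phi> \<circ> \<rho>) (z * w) = (\<phi> \<circ> \<rho>) z \<circ> (\<phi> \<circ> \<rho>) w" if "norm z = 1" "norm w = 1" for z w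
      using that SO2 by (simp add: mult \<phi>(2))
    show "continuous_on (sphere 0 1) (\<lambda>z. (\<phi> \<circ> \<rho>) z v)" for v
      using continuous_on_compose[OF cont, of "sphere 0 1" "\<lambda>A. \<phi> A v"] \<phi>(3)[of v] bij
      by (simp add: bij_betw_def o_def)
  qed
qed

text \<open>Transported to the circle, E becomes a continuous homomorphism \<psi> from the line. It
  is nontrivial by \<open>s0\<close>, hence onto.\<close>

theorem (in rotational) SO2_group_eq_range_exp:
  assumes T: "SO2_automorphism_group br T" and E: "\<And>s. E s \<in> T" and s0: "E s0 v0 \<noteq> v0"
  shows "T = range E"
proof -
  obtain \<eta> where bij: "bij_betw \<eta> (sphere (0::complex) 1) T"
    and hom: "\<And>z w. norm z = 1 \<Longrightarrow> norm w = 1 \<Longrightarrow> \<eta> (z * w) = \<eta> z \<circ> \<eta> w"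
    and cont: "\<And>v. continuous_on (sphere 0 1) (\<lambda>z. \<eta> z v)"
    using SO2_circle[OF T] by blast
  define g where "g = the_inv_into (sphere 0 1) \<eta>"
  have inj: "inj_on \<eta> (sphere 0 1)" and im: "\<eta> ` sphere 0 1 = T" using bij by (auto simp: bij_betw_def)
  have g: "g (\<eta> z) = z" if "norm z = 1" for z
    unfolding g_def using inj that by (simp add: the_inv_into_f_f)
  have \<eta>g: "\<eta> (g f) = f" and ng: "norm (g f) = 1" if "f \<in> T" for f
    using that im g by auto
  have bl: "bounded_linear f" if "f \<in> T" for f
    using T that by (simp add: SO2_automorphism_group_def lie_automorphism_def linear_conv_bounded_linear)
  \<comment> \<open>As bounded linear functions the elements of T carry the norm topology, in which
    pointwise continuity already gives continuity. Injectivity on the compact circle then makes the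
    inverse of \<open>F\<close> continuous.\<close>
  define F where "F z = Blinfun (\<eta> z)" for z
  have apF: "blinfun_apply (Blinfun f) = f" if "f \<in> T" for f
    using bl[OF that] by (rule bounded_linear_Blinfun_apply)
  have "continuous_on (sphere 0 1) F"
  proof (rule continuous_on_blinfun_componentwise)
    fix v :: 'a
    show "continuous_on (sphere 0 1) (\<lambda>z. blinfun_apply (F z) v)"
      using cont[of v] by (rule continuous_on_eq) (use im apF in \<open>auto simp: F_def\<close>)
  qed
  then have cg: "continuous_on (F ` sphere 0 1) (\<lambda>M. g (blinfun_apply M))"
    by (rule continuous_on_inv) (use im apF g in \<open>auto simp: F_def\<close>)
  have cE: "continuous_on UNIV (\<lambda>s. Blinfun (E s))"
    by (rule continuous_on_blinfun_componentwise) (simp add: apF E E_continuous)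
  define \<psi> where "\<psi> s = g (E s)" for s
  have "Blinfun (E s) \<in> F ` sphere 0 1" for s
    using \<eta>g[OF E] ng[OF E] by (intro rev_image_eqI[of "g (E s)"]) (auto simp: F_def)
  then have "continuous_on UNIV (\<lambda>s. g (blinfun_apply (Blinfun (E s))))"
    using continuous_on_compose2[OF cg cE] by auto
  then have c\<psi>: "continuous_on UNIV \<psi>" by (simp add: apF E \<psi>_def)
  have n\<psi>: "norm (\<psi> s) = 1" for s using ng[OF E] by (simp add: \<psi>_def)
  have h\<psi>: "\<psi> (s + t) = \<psi> s * \<psi> t" for s t
  proof -
    have "E (s + t) = \<eta> (\<psi> s * \<psi> t)"
      unfolding E_add using hom[OF n\<psi> n\<psi>] \<eta>g[OF E] by (simp add: \<psi>_def)
    then show ?thesis using g n\<psi> by (simp add: \<psi>_def norm_mult)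
  qed
  \<comment> \<open>Otherwise \<open>E s0\<close> would be \<eta> 1, an idempotent bijection and so
    the identity.\<close>
  have "\<psi> s0 \<noteq> 1"
  proof
    assume "\<psi> s0 = 1"
    then have "\<eta> 1 = E s0" using \<eta>g[OF E] by (metis \<psi>_def)
    then have idem: "E s0 \<circ> E s0 = E s0" using hom[of 1 1] by simp
    have "bij (E s0)" using T E by (simp add: SO2_automorphism_group_def lie_automorphism_def)
    then have "E s0 v0 = v0" using idem by (metis bij_is_inj comp_apply injD)
    then show False using s0 by simp
  qed
  note surj = circle_hom_surj[OF c\<psi> n\<psi> h\<psi> this]
  have "f \<in> range E" if f: "f \<in> T" for f
  proof -
    obtain s where "g f = \<psi> s" using surj[OF ng[OF f]] by blast
    then have "f = E s" using \<eta>g[OF f] \<eta>g[OF E] by (metis \<psi>_def)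
    then show ?thesis by blast
  qed
  then show ?thesis using E by blast
qed

subsection \<open>Matrices with blocks of size two\<close>

lemma J2_carrier: "J2 \<in> carrier_mat 2 2"
  unfolding J2_def mat_of_rows_list_def by (rule carrier_matI) simp_all

lemma J2_index: "J2 $$ (0, 0) = 0" "J2 $$ (0, Suc 0) = 1" "J2 $$ (Suc 0, 0) = -1" "J2 $$ (Suc 0, Suc 0) = 0"
  by (simp_all add: J2_def mat_of_rows_list_def)

lemma diag_block_mat_2:
  assumes "\<forall>A\<in>set As. A \<in> carrier_mat 2 2"
  shows "diag_block_mat As \<in> carrier_mat (2 * length As) (2 * length As) \<and>
    (\<forall>i<2 * length As. \<forall>j<2 * length As. diag_block_mat As $$ (i, j) =
       (if i div 2 = j div 2 then As ! (i div 2) $$ (i mod 2, j mod 2) else 0))"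
  using assms
proof (induction As)
  case (Cons A As)
  let ?B = "diag_block_mat As"
  have A: "A \<in> carrier_mat 2 2" and B: "?B \<in> carrier_mat (2 * length As) (2 * length As)"
    using Cons by auto
  have car: "diag_block_mat (A # As) \<in> carrier_mat (2 * length (A # As)) (2 * length (A # As))"
    using A B by (intro carrier_matI) (simp_all add: Let_def)
  have "diag_block_mat (A # As) $$ (i, j) =
      (if i div 2 = j div 2 then (A # As) ! (i div 2) $$ (i mod 2, j mod 2) else 0)"
    if i: "i < 2 * length (A # As)" and j: "j < 2 * length (A # As)" for i j
  proof -
    have idx: "diag_block_mat (A # As) $$ (i, j) =
        (if i < 2 then if j < 2 then A $$ (i, j) else 0
         else if j < 2 then 0 else ?B $$ (i - 2, j - 2))"
      using i j A B by (auto simp: Let_def)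
    consider "i < 2" | i' where "i = Suc (Suc i')" by (metis add_2_eq_Suc le_add_diff_inverse not_less)
    then show ?thesis
    proof cases
      case 1
      then show ?thesis by (subst idx) (cases "j < 2"; auto)
    next
      case i': 2
      consider "j < 2" | j' where "j = Suc (Suc j')" by (metis add_2_eq_Suc le_add_diff_inverse not_less)
      then show ?thesis
      proof cases
        case 1
        then show ?thesis using i' by (subst idx) simp
      next
        case j': 2
        then show ?thesis using Cons i j i' by (subst idx) simp
      qed
    qed
  qed
  then show ?case using car by blast
qed simp

lemma sum_two_blocks:
  fixes g :: "nat \<Rightarrow> 'b::comm_monoid_add"
  assumes "k < m" and "\<And>i. i < 2 * m \<Longrightarrow> i div 2 \<noteq> k \<Longrightarrow> g i = 0"
  shows "(\<Sum>i<2 * m. g i) = g (2 * k) + g (2 * k + 1)"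
proof -
  have "(\<Sum>i<2 * m. g i) = (\<Sum>i\<in>{2 * k, 2 * k + 1}. g i)"
  proof (rule sum.mono_neutral_right)
    show "\<forall>i\<in>{..<2 * m} - {2 * k, 2 * k + 1}. g i = 0"
    proof
      fix i assume i: "i \<in> {..<2 * m} - {2 * k, 2 * k + 1}"
      then have "i div 2 \<noteq> k" by auto
      then show "g i = 0" using assms(2) i by simp
    qed
  qed (use assms(1) in auto)
  then show ?thesis by simp
qed

text \<open>The minus sign reflects the column convention: the first column of c J is (0, -
  c).\<close>

lemma has_matrix_rotation_blocks:
  fixes b :: "'a::euclidean_space list"
  assumes len: "length b = 2 * length cs"
  shows "has_matrix b D (t \<cdot>\<^sub>m diag_block_mat (map (\<lambda>c. c \<cdot>\<^sub>m J2) cs)) \<longleftrightarrow> linear D \<and>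
    (\<forall>k<length cs. D (b ! (2 * k)) = - (t * cs ! k) *\<^sub>R b ! (2 * k + 1) \<and>
       D (b ! (2 * k + 1)) = (t * cs ! k) *\<^sub>R b ! (2 * k))"
proof -
  let ?As = "map (\<lambda>c. c \<cdot>\<^sub>m J2) cs"
  let ?M = "t \<cdot>\<^sub>m diag_block_mat ?As"
  have As: "\<forall>A\<in>set ?As. A \<in> carrier_mat 2 2" using J2_carrier by auto
  have car: "?M \<in> carrier_mat (length b) (length b)"
    using diag_block_mat_2[OF As] by (simp add: len)
  have idx: "?M $$ (i, j) = (if i div 2 = j div 2 then t * (cs ! (i div 2) * J2 $$ (i mod 2, j mod 2)) else 0)"
    if "i < length b" "j < length b" for i j
  proof -
    have "i mod 2 < 2" "j mod 2 < 2" by simp_all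
    then show ?thesis
      using diag_block_mat_2[OF As] that J2_carrier by (auto simp: len)
  qed
  have sum: "(\<Sum>i<length b. ?M $$ (i, j) *\<^sub>R b ! i) =
      (t * (cs ! k * J2 $$ (0, j mod 2))) *\<^sub>R b ! (2 * k) + (t * (cs ! k * J2 $$ (1, j mod 2))) *\<^sub>R b ! (2 * k + 1)"
    if "k < length cs" "j div 2 = k" for j k
  proof -
    have j: "j < length b" using that len by auto
    have "(\<Sum>i<2 * length cs. ?M $$ (i, j) *\<^sub>R b ! i) =
        ?M $$ (2 * k, j) *\<^sub>R b ! (2 * k) + ?M $$ (2 * k + 1, j) *\<^sub>R b ! (2 * k + 1)"
      using j that by (intro sum_two_blocks) (auto simp: idx len)
    then show ?thesis using that len j by (simp add: idx)
  qed
  have "(\<forall>j<length b. D (b ! j) = (\<Sum>i<length b. ?M $$ (i, j) *\<^sub>R b ! i)) \<longleftrightarrow>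
      (\<forall>k<length cs. D (b ! (2 * k)) = - (t * cs ! k) *\<^sub>R b ! (2 * k + 1) \<and>
         D (b ! (2 * k + 1)) = (t * cs ! k) *\<^sub>R b ! (2 * k))" (is "(\<forall>j<length b. ?P j) \<longleftrightarrow> _")
  proof -
    have "(\<forall>j<length b. ?P j) \<longleftrightarrow> (\<forall>k<length cs. ?P (2 * k) \<and> ?P (2 * k + 1))"
    proof
      assume R: "\<forall>k<length cs. ?P (2 * k) \<and> ?P (2 * k + 1)"
      show "\<forall>j<length b. ?P j"
      proof (intro allI impI)
        fix j assume j: "j < length b"
        obtain k where k: "j = 2 * k \<or> j = 2 * k + 1" by (metis evenE oddE)
        then have "k < length cs" using j len by auto
        then have "?P (2 * k) \<and> ?P (2 * k + 1)" using R by blast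
        then show "?P j" using k by (elim disjE) (simp_all only:)
      qed
    qed (simp add: len)
    also have "\<dots> \<longleftrightarrow> (\<forall>k<length cs. D (b ! (2 * k)) = - (t * cs ! k) *\<^sub>R b ! (2 * k + 1) \<and>
         D (b ! (2 * k + 1)) = (t * cs ! k) *\<^sub>R b ! (2 * k))"
    proof -
      have "?P (2 * k) \<longleftrightarrow> D (b ! (2 * k)) = - (t * cs ! k) *\<^sub>R b ! (2 * k + 1)" if "k < length cs" for k
        using sum[OF that, of "2 * k"] by (simp add: J2_index)
      moreover have "?P (2 * k + 1) \<longleftrightarrow> D (b ! (2 * k + 1)) = (t * cs ! k) *\<^sub>R b ! (2 * k)" if "k < length cs" for k
        using sum[OF that, of "2 * k + 1"] by (simp add: J2_index)
      ultimately show ?thesis by blast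
    qed
    finally show ?thesis .
  qed
  then show ?thesis using car by (simp add: has_matrix_def)
qed

lemma rep_diag_2: "rep_diag 2 A = A"
  by (simp add: rep_diag_def del: diag_block_mat.simps)

text \<open>Blocks are numbered from 1; truncated subtraction gives the empty sum for p = 0.\<close>

lemma block_start_2: "block_start (\<lambda>_. 2) p = 2 * (p - 1)"
  by (simp add: block_start_def)

lemma block_of_2: "block_of (\<lambda>_. 2) i = i div 2 + 1"
  unfolding block_of_def block_start_2 by (rule Least_equality) auto

lemma alternating_tridiagonal_2_carrier:
  "alternating_tridiagonal k (\<lambda>_. 2) W \<in> carrier_mat (2 * k) (2 * k)"
  by (simp add: alternating_tridiagonal_def mat_of_blocks_def mult.commute)

lemma alternating_tridiagonal_2_index:
  assumes "i < 2 * k" "j < 2 * k" and "\<And>p. W p \<in> carrier_mat 2 2"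
  shows "alternating_tridiagonal k (\<lambda>_. 2) W $$ (i, j) =
    (if j div 2 = Suc (i div 2) then W (i div 2 + 1) $$ (i mod 2, j mod 2)
     else if i div 2 = Suc (j div 2) then - W (j div 2 + 1) $$ (j mod 2, i mod 2) else 0)"
proof -
  have "i - 2 * (i div 2) = i mod 2" "j - 2 * (j div 2) = j mod 2" by presburger+
  moreover have "i mod 2 < 2" "j mod 2 < 2" by simp_all
  ultimately show ?thesis
    using assms(1,2) assms(3)[of "Suc (i div 2)"] assms(3)[of "Suc (j div 2)"]
    by (simp add: alternating_tridiagonal_def mat_of_blocks_def block_of_2 block_start_2 Let_def mult.commute)
qed

lemma real_form_one: "real_form (1\<^sub>m 1) = 1\<^sub>m 2"
  by (rule eq_matI) (auto simp: real_form_def Let_def less_2_cases_iff)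

lemma prepend_zero_cols_0: "prepend_zero_cols 0 B = B"
  by (rule eq_matI) (auto simp: prepend_zero_cols_def)

lemma identity_with_zero_rows_one: "identity_with_zero_rows 1 (1\<^sub>m 1)"
  unfolding identity_with_zero_rows_def
  by (rule exI[of _ "\<lambda>_. 0"]) (auto simp: strict_mono_on_def intro!: eq_matI)

lemma length_concat_pairs: "length (concat (map (\<lambda>k. [e k, f k]) [0..<m])) = 2 * m"
  by (induction m) auto

lemma nth_concat_pairs:
  assumes "k < m"
  shows "concat (map (\<lambda>k. [e k, f k]) [0..<m]) ! (2 * k) = e k"
    and "concat (map (\<lambda>k. [e k, f k]) [0..<m]) ! (2 * k + 1) = f k"
proof -
  have "concat (map (\<lambda>k. [e k, f k]) [0..<m]) ! (2 * k) = e k \<and>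
      concat (map (\<lambda>k. [e k, f k]) [0..<m]) ! (2 * k + 1) = f k"
    using assms
  proof (induction m)
    case (Suc m)
    then show ?case by (cases "k = m") (simp_all add: nth_append length_concat_pairs)
  qed simp
  then show "concat (map (\<lambda>k. [e k, f k]) [0..<m]) ! (2 * k) = e k"
    and "concat (map (\<lambda>k. [e k, f k]) [0..<m]) ! (2 * k + 1) = f k" by blast+
qed

subsection \<open>The normal form\<close>

lemma ordered_basis_linear_exists:
  assumes b: "ordered_basis b"
  shows "\<exists>g. linear g \<and> (\<forall>j<length b. g (b ! j) = h j)"
proof -
  have d: "distinct b" and i: "independent (set b)" using b by (auto simp: ordered_basis_def)
  define k where "k = the_inv_into {..<length b} ((!) b)"
  have k: "k (b ! j) = j" if "j < length b" for j
    unfolding k_def by (rule the_inv_into_f_f[OF inj_on_nth[OF d]]) (use that in auto)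
  obtain g where "linear g" "\<forall>v\<in>set b. g v = h (k v)"
    using linear_independent_extend[OF i, of "\<lambda>v. h (k v)"] by blast
  then show ?thesis using k by (intro exI[of _ g]) simp
qed

lemma ordered_basis_linear_eq:
  assumes b: "ordered_basis b" and fg: "linear f" "linear g"
    and eq: "\<And>j. j < length b \<Longrightarrow> f (b ! j) = g (b ! j)"
  shows "f v = g v"
proof (rule linear_eq_on[OF fg])
  show "v \<in> span (set b)" using b by (simp add: ordered_basis_def)
  show "f u = g u" if "u \<in> set b" for u using that eq by (auto simp: in_set_conv_nth)
qed

text \<open>Serves twice: in the given basis it puts D into the Lie algebra of T, and in the final
  basis it shows that the new matrices describe the same line of derivations.\<close>

lemma has_matrix_rotation_multiples:
  fixes b :: "'a::euclidean_space list"
  assumes b: "ordered_basis b" and len: "length b = 2 * length cs" and D: "linear D"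
    and rot: "\<And>k. k < length cs \<Longrightarrow> D (b ! (2 * k)) = - (cs ! k) *\<^sub>R b ! (2 * k + 1) \<and>
      D (b ! (2 * k + 1)) = cs ! k *\<^sub>R b ! (2 * k)"
  shows "{D'. \<exists>t. has_matrix b D' (t \<cdot>\<^sub>m diag_block_mat (map (\<lambda>c. c \<cdot>\<^sub>m J2) cs))} =
    range (\<lambda>t v. t *\<^sub>R D v)"
proof -
  have lin: "linear (\<lambda>v. t *\<^sub>R D v)" for t by (intro linear_compose_scale_right D)
  have "has_matrix b D' (t \<cdot>\<^sub>m diag_block_mat (map (\<lambda>c. c \<cdot>\<^sub>m J2) cs)) \<longleftrightarrow> D' = (\<lambda>v. t *\<^sub>R D v)" for D' t
  proof
    assume "D' = (\<lambda>v. t *\<^sub>R D v)"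
    then show "has_matrix b D' (t \<cdot>\<^sub>m diag_block_mat (map (\<lambda>c. c \<cdot>\<^sub>m J2) cs))"
      using lin rot by (simp add: has_matrix_rotation_blocks[OF len])
  next
    assume "has_matrix b D' (t \<cdot>\<^sub>m diag_block_mat (map (\<lambda>c. c \<cdot>\<^sub>m J2) cs))"
    then have D': "linear D'" "\<And>k. k < length cs \<Longrightarrow> D' (b ! (2 * k)) = - (t * cs ! k) *\<^sub>R b ! (2 * k + 1) \<and>
        D' (b ! (2 * k + 1)) = (t * cs ! k) *\<^sub>R b ! (2 * k)"
      unfolding has_matrix_rotation_blocks[OF len] by blast+
    have "D' v = t *\<^sub>R D v" for v
    proof (rule ordered_basis_linear_eq[OF b D'(1) lin])
      fix j assume j: "j < length b"
      obtain k where k: "j = 2 * k \<or> j = 2 * k + 1" by (metis evenE oddE)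
      then have "k < length cs" using j len by auto
      then show "D' (b ! j) = t *\<^sub>R D (b ! j)" using k D'(2)[of k] rot[of k] by auto
    qed
    then show "D' = (\<lambda>v. t *\<^sub>R D v)" by blast
  qed
  then show ?thesis by auto
qed

lemma graded_derivation_exists:
  fixes br :: "'a::euclidean_space \<Rightarrow> 'a \<Rightarrow> 'a"
  assumes h: "nilpotent_type_2 n br" and b: "adapted_basis br n es x y"
    and n: "n = 2 * length \<alpha>s" and D: "linear D" "\<And>u v. D (br u v) = br (D u) v + br u (D v)"
    and rot: "\<And>k. k < length \<alpha>s \<Longrightarrow> D (es ! (2 * k)) = - (\<alpha>s ! k) *\<^sub>R es ! (2 * k + 1) \<and>
      D (es ! (2 * k + 1)) = \<alpha>s ! k *\<^sub>R es ! (2 * k)"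
    and Dx: "D x = - y" and Dy: "D y = x" and half: "\<And>a. a \<in> set \<alpha>s \<Longrightarrow> a > 1/2"
  obtains pr where "graded_derivation br D pr (set \<alpha>s) x y" "\<And>a. a \<in> set \<alpha>s \<Longrightarrow> \<exists>v. pr a v \<noteq> 0"
proof -
  let ?b = "es @ [x, y]"
  have len: "length es = n" and ob: "ordered_basis ?b" and comm: "span {x, y} = commutator_ideal br"
    using b by (auto simp: adapted_basis_def)
  have lie: "bilinear br" "\<And>u. br u u = 0" and centre: "commutator_ideal br = lie_centre br"
    using h by (auto simp: nilpotent_type_2_def lie_bracket_def)
  \<comment> \<open>\<open>pr a\<close> keeps the basis vectors whose pair has coefficient a, so
    pairs with equal coefficients are merged into one isotypic piece; x and y go to 0.\<close>
  have "\<exists>g. linear g \<and> (\<forall>j<length ?b. g (?b ! j) = (if j < n \<and> \<alpha>s ! (j div 2) = a then ?b ! j else 0))" for a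
    by (rule ordered_basis_linear_exists[OF ob])
  then obtain pr where linpr: "\<And>a. linear (pr a)"
    and pr: "\<And>a j. j < length ?b \<Longrightarrow> pr a (?b ! j) = (if j < n \<and> \<alpha>s ! (j div 2) = a then ?b ! j else 0)"
    by metis
  have pr_es: "pr a (es ! j) = (if \<alpha>s ! (j div 2) = a then es ! j else 0)" if "j < n" for a j
    using pr[of j a] that len by (simp add: nth_append)
  have pr_xy: "pr a x = 0" "pr a y = 0" for a
    using pr[of n a] pr[of "Suc n" a] len by (simp_all add: nth_append)
  have basis_eq: "F v = G v" if "linear F" "linear G" "\<And>j. j < n \<Longrightarrow> F (es ! j) = G (es ! j)"
    "F x = G x" "F y = G y" for F G :: "'a \<Rightarrow> 'a" and v
  proof (rule ordered_basis_linear_eq[OF ob that(1,2)])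
    fix j assume "j < length ?b"
    then consider "j < n" | "j = n" | "j = Suc n" using len by fastforce
    then show "F (?b ! j) = G (?b ! j)" using that(3-5) len by cases (auto simp: nth_append)
  qed
  have parity: "\<exists>k<length \<alpha>s. j = 2 * k \<or> j = 2 * k + 1" if "j < n" for j
  proof -
    obtain k where "j = 2 * k \<or> j = 2 * k + 1" by (metis evenE oddE)
    then show ?thesis using that n by (intro exI[of _ k]) auto
  qed
  note D_simps = linear_0[OF D(1)] linear_neg[OF D(1)] linear_scale[OF D(1)]
  note pr_simps = linear_0[OF linpr] linear_neg[OF linpr] linear_scale[OF linpr]
  have pr_D: "pr a (D v) = D (pr a v)" for a v
  proof (rule basis_eq[of "\<lambda>v. pr a (D v)" "\<lambda>v. D (pr a v)"])
    show "linear (\<lambda>v. pr a (D v))" "linear (\<lambda>v. D (pr a v))"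
      using linear_compose[OF D(1) linpr] linear_compose[OF linpr D(1)] by (simp_all add: o_def)
    fix j assume j: "j < n"
    obtain k where k: "k < length \<alpha>s" "j = 2 * k \<or> j = 2 * k + 1" using parity[OF j] by blast
    have "pr a (es ! (2 * k)) = (if \<alpha>s ! k = a then es ! (2 * k) else 0)"
      "pr a (es ! (2 * k + 1)) = (if \<alpha>s ! k = a then es ! (2 * k + 1) else 0)"
      using k(1) n pr_es[of "2 * k" a] pr_es[of "2 * k + 1" a] by simp_all
    then show "pr a (D (es ! j)) = D (pr a (es ! j))"
      using k(2) rot[OF k(1)] by (auto simp: D_simps pr_simps)
  qed (simp_all add: Dx Dy pr_xy D_simps pr_simps)
  have DD_pr: "D (D (pr a v)) = - (a\<^sup>2) *\<^sub>R pr a v" for a v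
  proof (rule basis_eq[of "\<lambda>v. D (D (pr a v))" "\<lambda>v. - (a\<^sup>2) *\<^sub>R pr a v"])
    show "linear (\<lambda>v. D (D (pr a v)))" "linear (\<lambda>v. - (a\<^sup>2) *\<^sub>R pr a v)"
      using linear_compose[OF linear_compose[OF linpr D(1)] D(1)]
      by (simp_all add: o_def linear_compose_scale_right linpr linear_compose_neg)
    fix j assume j: "j < n"
    obtain k where k: "k < length \<alpha>s" "j = 2 * k \<or> j = 2 * k + 1" using parity[OF j] by blast
    have "j div 2 = k" using k(2) by auto
    then have p: "pr a (es ! j) = (if \<alpha>s ! k = a then es ! j else 0)"
      using pr_es[OF j, of a] by simp
    have "D (D (es ! j)) = - ((\<alpha>s ! k)\<^sup>2) *\<^sub>R es ! j"
      using k(2) rot[OF k(1)] by (auto simp: D_simps power2_eq_square)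
    then show "D (D (pr a (es ! j))) = - (a\<^sup>2) *\<^sub>R pr a (es ! j)"
      unfolding p by (auto simp: D_simps)
  qed (simp_all add: pr_xy D_simps)
  have pr_pr: "pr a (pr c v) = (if a = c then pr a v else 0)" for a c v
  proof (rule basis_eq[of "\<lambda>v. pr a (pr c v)" "\<lambda>v. if a = c then pr a v else 0"])
    show "linear (\<lambda>v. pr a (pr c v))" "linear (\<lambda>v. if a = c then pr a v else 0)"
      using linear_compose[OF linpr linpr]
      by (simp_all add: o_def) (cases "a = c"; simp add: linpr linear_zero)
  qed (auto simp: pr_es pr_xy pr_simps)
  have pr_notin: "pr a v = 0" if a: "a \<notin> set \<alpha>s" for a v
  proof (rule basis_eq[of "pr a" "\<lambda>_. 0"])
    fix j assume j: "j < n"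
    then have "\<alpha>s ! (j div 2) \<noteq> a" using a n nth_mem[of "j div 2" \<alpha>s] by auto
    then show "pr a (es ! j) = 0" using pr_es[OF j, of a] by simp
  qed (simp_all add: linpr linear_zero pr_xy)
  have pr_sum: "v - (\<Sum>a\<in>set \<alpha>s. pr a v) \<in> span {x, y}" for v
  proof -
    define G where "G v = v - (\<Sum>a\<in>set \<alpha>s. pr a v)" for v
    have "linear G"
      unfolding G_def by (intro linear_compose_sub linear_compose_sum ballI linpr) (simp add: linear_iff)
    then have sub: "subspace {v. G v \<in> span {x, y}}"
      by (rule linear_subspace_linear_preimage) (rule subspace_span)
    have "G u \<in> span {x, y}" if u: "u \<in> set ?b" for u
    proof -
      consider "u = x \<or> u = y" | j where "j < n" "u = es ! j"
        using u len by (auto simp: in_set_conv_nth)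
      then show ?thesis
      proof cases
        case 1
        then show ?thesis by (auto simp: G_def pr_xy intro: span_base)
      next
        case (2 j)
        then have "\<alpha>s ! (j div 2) \<in> set \<alpha>s" using n by (intro nth_mem) auto
        then have "(\<Sum>a\<in>set \<alpha>s. pr a u) = u" using 2 by (simp add: pr_es)
        then show ?thesis by (simp add: G_def span_0)
      qed
    qed
    then have "span (set ?b) \<subseteq> {v. G v \<in> span {x, y}}" by (intro span_minimal sub) blast
    then show ?thesis using ob by (auto simp: G_def ordered_basis_def)
  qed
  have "graded_derivation br D pr (set \<alpha>s) x y"
  proof (rule graded_derivation.intro)
    show "br u v \<in> span {x, y}" for u v
      unfolding comm commutator_ideal_def by (intro span_base) blast
    show "br z v = 0" if "z \<in> span {x, y}" for z v
      using that comm centre by (simp add: lie_centre_def)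
    have "{x, y} \<subseteq> set ?b" by auto
    then show "independent {x, y}" using ob independent_mono unfolding ordered_basis_def by blast
    show "x \<noteq> y" using ob by (auto simp: ordered_basis_def)
    show "pr a z = 0" if "z \<in> span {x, y}" for a z
      using span_minimal[OF _ linear_subspace_kernel[OF linpr[of a]], of "{x, y}"] that pr_xy by auto
  qed (use lie D Dx Dy linpr pr_pr pr_D DD_pr pr_notin pr_sum half in auto)
  moreover have "\<exists>v. pr a v \<noteq> 0" if a: "a \<in> set \<alpha>s" for a
  proof -
    obtain k where k: "k < length \<alpha>s" "a = \<alpha>s ! k" using a by (metis in_set_conv_nth)
    then have "pr a (es ! (2 * k)) = es ! (2 * k)" using pr_es[of "2 * k" a] n by simp
    moreover have "es ! (2 * k) \<in> set ?b" using k(1) n len by simp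
    then have "es ! (2 * k) \<noteq> 0" using ob dependent_zero unfolding ordered_basis_def by metis
    ultimately show ?thesis by metis
  qed
  ultimately show ?thesis using that by blast
qed

text \<open>In the four brackets of neighbouring planes, the coefficients of x form the identity and
  those of y form J.\<close>

lemma described_by_alternating_tridiagonal_2:
  fixes br :: "'a::euclidean_space \<Rightarrow> 'a \<Rightarrow> 'a"
  assumes alt: "\<And>u v. br v u = - br u v"
    and step: "\<And>k. k < l \<Longrightarrow> br (e k) (e (Suc k)) = x \<and> br (e k) (f (Suc k)) = y \<and>
           br (f k) (e (Suc k)) = - y \<and> br (f k) (f (Suc k)) = x"
    and zero: "\<And>j k u v. j \<le> l \<Longrightarrow> k \<le> l \<Longrightarrow> j \<noteq> Suc k \<Longrightarrow> k \<noteq> Suc j \<Longrightarrow>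
           u \<in> {e j, f j} \<Longrightarrow> v \<in> {e k, f k} \<Longrightarrow> br u v = 0"
  shows "described_by br (concat (map (\<lambda>k. [e k, f k]) [0..<Suc l])) x y
    (alternating_tridiagonal (l + 1) (\<lambda>_. 2) (\<lambda>_. 1\<^sub>m 2)) (alternating_tridiagonal (l + 1) (\<lambda>_. 2) (\<lambda>_. J2))"
proof -
  let ?es = "concat (map (\<lambda>k. [e k, f k]) [0..<Suc l])"
  define T1 where "T1 = alternating_tridiagonal (l + 1) (\<lambda>_. 2) (\<lambda>_. 1\<^sub>m 2)"
  define T2 where "T2 = alternating_tridiagonal (l + 1) (\<lambda>_. 2) (\<lambda>_. J2)"
  have len: "length ?es = 2 * (l + 1)" using length_concat_pairs[of e f "Suc l"] by simp
  have "br (?es ! i) (?es ! j) = T1 $$ (i, j) *\<^sub>R x + T2 $$ (i, j) *\<^sub>R y"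
    if i: "i < length ?es" and j: "j < length ?es" for i j
  proof -
    obtain p where p: "i = 2 * p \<or> i = 2 * p + 1" by (metis evenE oddE)
    obtain q where q: "j = 2 * q \<or> j = 2 * q + 1" by (metis evenE oddE)
    have pl: "p < Suc l" and ql: "q < Suc l" using i j p q len by auto
    have ei: "?es ! i = (if even i then e p else f p)" and ej: "?es ! j = (if even j then e q else f q)"
      using p q nth_concat_pairs[OF pl, of e f] nth_concat_pairs[OF ql, of e f] by (auto simp del: upt_Suc)
    have i2: "i div 2 = p" "i mod 2 = (if even i then 0 else 1)"
      and j2: "j div 2 = q" "j mod 2 = (if even j then 0 else 1)"
      using p q by (auto simp: odd_iff_mod_2_eq_one)
    have T1: "T1 $$ (i, j) = (if q = Suc p \<and> (even i \<longleftrightarrow> even j) then 1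
        else if p = Suc q \<and> (even i \<longleftrightarrow> even j) then - 1 else 0)"
      using i j len unfolding T1_def T2_def by (subst alternating_tridiagonal_2_index) (auto simp: i2 j2)
    \<comment> \<open>Because - J' = J, the entries below the diagonal blocks follow the same
      pattern as those above.\<close>
    have T2: "T2 $$ (i, j) = (if q = Suc p then (if even i \<and> odd j then 1 else if odd i \<and> even j then - 1 else 0)
        else if p = Suc q then (if even i \<and> odd j then 1 else if odd i \<and> even j then - 1 else 0) else 0)"
      using i j len unfolding T1_def T2_def by (subst alternating_tridiagonal_2_index) (auto simp: i2 j2 J2_index J2_carrier)
    consider "q = Suc p" | "p = Suc q" | "q \<noteq> Suc p" "p \<noteq> Suc q" by blast
    then show ?thesis
    proof cases
      case 1
      then show ?thesis using step[of p] ql by (auto simp: T1 T2 ei ej simp del: upt_Suc)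
    next
      case 2
      then show ?thesis using step[of q] pl alt[of "e p" "e q"] alt[of "e p" "f q"] alt[of "f p" "e q"] alt[of "f p" "f q"]
        by (auto simp: T1 T2 ei ej simp del: upt_Suc)
    next
      case 3
      have "?es ! i \<in> {e p, f p}" "?es ! j \<in> {e q, f q}" using ei ej by auto
      then have "br (?es ! i) (?es ! j) = 0" using zero[of p q] pl ql 3 by simp
      then show ?thesis using 3 by (simp add: T1 T2 del: upt_Suc)
    qed
  qed
  then show ?thesis
    using alternating_tridiagonal_2_carrier[of "l + 1"]
    unfolding described_by_def len T1_def T2_def by blast
qed

theorem theorem8:
  fixes br :: "'a::euclidean_space \<Rightarrow> 'a \<Rightarrow> 'a"
    and T :: "('a \<Rightarrow> 'a) set"
    and n :: nat and \<alpha>s :: "real list" and \<alpha> \<beta> :: real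
  assumes "nilpotent_type_2 n br" and "n \<ge> 3"
    and "SO2_automorphism_group br T"
    and "\<not> T_decomposable br T"
    and "action_coefficients br T n \<alpha>s \<beta>"
    and "\<beta> = 1"
    and "\<alpha> = Min (all_coefficients n \<alpha>s)"
    and "\<alpha> > 1 / 2"
  shows "\<exists>(l::nat) (es::'a list) x y (d::nat \<Rightarrow> nat) (r::nat \<Rightarrow> nat)
            (What::nat \<Rightarrow> complex mat) (W::nat \<Rightarrow> real mat) T1 T2.
      adapted_basis br n es x y \<and>
      (\<forall>i\<in>{1..l+1}. even (d i) \<and> d i > 0) \<and>
      (\<Sum>i\<in>{1..l+1}. d i) = n \<and>
      T = {lin_exp D | D. \<exists>t. has_matrix (es @ [x, y]) D
             (t \<cdot>\<^sub>m diag_block_mat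
                (map (\<lambda>i. rep_diag (d i) ((\<alpha> + real i - 1) \<cdot>\<^sub>m J2)) [1..<l+2] @ [J2]))} \<and>
      described_by br es x y T1 T2 \<and>
      T1 = alternating_tridiagonal (l+1) d W \<and>
      T2 = alternating_tridiagonal (l+1) d (\<lambda>i. W i * rep_diag (d (i+1)) J2) \<and>
      (\<forall>i\<in>{1..l}. W i \<in> carrier_mat (d i) (d (i+1)) \<and>
         W i = real_form (What i) \<and> almost_echelon (r i) (What i)) \<and>
      (l \<ge> 1 \<longrightarrow> (\<exists>c. What 1 = prepend_zero_cols c (1\<^sub>m (r 1))) \<and>
                 identity_with_zero_rows (r l) (What l)) \<and>
      (\<forall>j\<in>{1..n div 2}. \<not> (col T1 (2*j-2) = 0\<^sub>v n \<and> col T1 (2*j-1) = 0\<^sub>v n))"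
proof -
  have fin: "finite (all_coefficients n \<alpha>s)" by (simp add: all_coefficients_def)
  \<comment> \<open>For odd n the coefficient \<alpha>_0 = 0 would be the minimum.\<close>
  have "even n"
  proof (rule ccontr)
    assume "odd n"
    then have "0 \<in> all_coefficients n \<alpha>s" by (simp add: all_coefficients_def)
    then show False using Min_le[OF fin] assms(7,8) by fastforce
  qed
  then have coeffs: "all_coefficients n \<alpha>s = set \<alpha>s" by (simp add: all_coefficients_def)
  have n: "n = 2 * length \<alpha>s" using assms(5) \<open>even n\<close> by (simp add: action_coefficients_def)
  then have "set \<alpha>s \<noteq> {}" using assms(2) by auto
  then have \<alpha>: "\<alpha> \<in> set \<alpha>s" "\<And>a. a \<in> set \<alpha>s \<Longrightarrow> \<alpha> \<le> a"
    using assms(7) by (auto simp: coeffs)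
  have half: "a > 1/2" if "a \<in> set \<alpha>s" for a using \<alpha>(2)[OF that] assms(8) by simp
  obtain es x y where ab: "adapted_basis br n es x y"
    and La: "lie_algebra_of T = {D. \<exists>t. has_matrix (es @ [x, y]) D (action_matrix n \<alpha>s 1 t)}"
    using assms(5,6) by (auto simp: action_coefficients_def)
  let ?b = "es @ [x, y]" and ?cs = "\<alpha>s @ [1]"
  have len: "length es = n" and ob: "ordered_basis ?b" and comm: "span {x, y} = commutator_ideal br"
    using ab by (auto simp: adapted_basis_def)
  have lenb: "length ?b = 2 * length ?cs" using len n by simp
  \<comment> \<open>This D is the matrix of the action at t = 1.\<close>
  obtain D where D: "linear D" "\<And>j. j < length ?b \<Longrightarrow> D (?b ! j) =
      (if even j then - (?cs ! (j div 2)) *\<^sub>R ?b ! (j + 1) else ?cs ! (j div 2) *\<^sub>R ?b ! (j - 1))"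
    using ordered_basis_linear_exists[OF ob, of "\<lambda>j. if even j then - (?cs ! (j div 2)) *\<^sub>R ?b ! (j + 1)
        else ?cs ! (j div 2) *\<^sub>R ?b ! (j - 1)"] by blast
  have rotb: "D (?b ! (2 * k)) = - (?cs ! k) *\<^sub>R ?b ! (2 * k + 1) \<and> D (?b ! (2 * k + 1)) = ?cs ! k *\<^sub>R ?b ! (2 * k)"
    if "k < length ?cs" for k
    using D(2)[of "2 * k"] D(2)[of "2 * k + 1"] that lenb by simp
  have act: "action_matrix n \<alpha>s 1 t = t \<cdot>\<^sub>m diag_block_mat (map (\<lambda>c. c \<cdot>\<^sub>m J2) ?cs)" for t
    using \<open>even n\<close> by (simp add: action_matrix_def)
  have "lie_algebra_of T = range (\<lambda>t v. t *\<^sub>R D v)"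
    unfolding La act by (rule has_matrix_rotation_multiples[OF ob lenb D(1) rotb])
  moreover have "D = (\<lambda>v. 1 *\<^sub>R D v)" by simp
  ultimately have "D \<in> lie_algebra_of T" by (metis rangeI)
  then have expT: "lin_exp (\<lambda>v. s *\<^sub>R D v) \<in> T" for s by (simp add: lie_algebra_of_def)
  interpret rotational D "set ?b"
  proof (rule rotational.intro)
    show "\<exists>c w. D u = - c *\<^sub>R w \<and> D w = c *\<^sub>R u" if u: "u \<in> set ?b" for u
    proof -
      obtain j where j: "j < length ?b" "u = ?b ! j" using u by (metis in_set_conv_nth)
      obtain k where k: "j = 2 * k \<or> j = 2 * k + 1" by (metis evenE oddE)
      then have kl: "k < length ?cs" using j lenb by auto
      from k show ?thesis
      proof
        assume "j = 2 * k"
        then show ?thesis using rotb[OF kl] j(2) by blast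
      next
        assume "j = 2 * k + 1"
        \<comment> \<open>Seen from the second vector of a pair, the rotation runs backwards, so c
          changes sign.\<close>
        then have "D u = - (- (?cs ! k)) *\<^sub>R ?b ! (2 * k) \<and> D (?b ! (2 * k)) = (- (?cs ! k)) *\<^sub>R u"
          using rotb[OF kl] j(2) by simp
        then show ?thesis by blast
      qed
    qed
  qed (use D(1) ob in \<open>auto simp: ordered_basis_def\<close>)
  have Dxy: "D x = - y" "D y = x"
    using rotb[of "length \<alpha>s"] len n by (simp_all add: nth_append)
  have rot_es: "D (es ! (2 * k)) = - (\<alpha>s ! k) *\<^sub>R es ! (2 * k + 1) \<and> D (es ! (2 * k + 1)) = \<alpha>s ! k *\<^sub>R es ! (2 * k)"
    if "k < length \<alpha>s" for k
    using rotb[of k] that len n by (simp add: nth_append)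
  have "x \<in> set ?b" by simp
  then have "x \<noteq> 0" using ob dependent_zero unfolding ordered_basis_def by metis
  \<comment> \<open>Since \<beta> = 1, half a turn acts as - 1 on the centre; this is the nontrivial
    element needed to fill the circle.\<close>
  have "E pi x = - x"
    using E_rotation(1)[of x 1 y pi] Dxy by simp
  moreover have "- x \<noteq> x"
  proof
    assume "- x = x"
    then have "2 *\<^sub>R x = 0" unfolding scaleR_2 neg_eq_iff_add_eq_0 .
    then show False using \<open>x \<noteq> 0\<close> by simp
  qed
  ultimately have "E pi x \<noteq> x" by simp
  then have TE: "T = range E"
    by (rule SO2_group_eq_range_exp[OF assms(3) expT])
  have bil: "bilinear br" and alt: "\<And>u. br u u = 0"
    using assms(1) by (auto simp: nilpotent_type_2_def lie_bracket_def)
  have "E s (br u v) = br (E s u) (E s v)" for s u v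
    using assms(3) expT[of s] by (simp add: SO2_automorphism_group_def lie_automorphism_def)
  then have der: "D (br u v) = br (D u) v + br u (D v)" for u v
    by (rule derivation_if_automorphisms[OF bil])
  obtain pr where gd: "graded_derivation br D pr (set \<alpha>s) x y"
    and S_nz: "\<And>a. a \<in> set \<alpha>s \<Longrightarrow> \<exists>v. pr a v \<noteq> 0"
    using graded_derivation_exists[OF assms(1) ab n D(1) der rot_es Dxy half] by blast
  interpret graded_derivation br D pr "set \<alpha>s" x y by (rule gd)
  \<comment> \<open>Now that T consists of exponentials of multiples of D, D-invariant subspaces are
    T-invariant, and a splitting with two nonzero sides contradicts undecomposability.\<close>
  interpret undecomposable_derivation br D pr "set \<alpha>s" x y \<alpha>
  proof
    show "(\<forall>a\<in>set \<alpha>s. P a \<subseteq> {0}) \<or> (\<forall>a\<in>set \<alpha>s. Q a \<subseteq> {0})" if s: "splits (set \<alpha>s) P Q" for P Q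
    proof (rule ccontr)
      assume "\<not> ?thesis"
      then obtain a p c q where apcq: "a \<in> set \<alpha>s" "p \<in> P a" "p \<noteq> 0" "c \<in> set \<alpha>s" "q \<in> Q c" "q \<noteq> 0" by blast
      have "g ` W \<subseteq> W" if g: "g \<in> T" and W: "subspace W" "\<And>v. v \<in> W \<Longrightarrow> D v \<in> W" for g W
      proof -
        obtain t where t: "g = E t" using g TE by blast
        have "E t v \<in> W" if "v \<in> W" for v
          using W that by (intro lin_exp_mem_subspace[OF linear_scaleD]) (auto intro: subspace_scale)
        then show ?thesis using t by blast
      qed
      then have "T_decomposable br T"
        using splits_imp_T_decomposable[OF s comm[symmetric] _ apcq] by blast
      then show False using assms(4) by blast
    qed
  qed (use S_nz \<alpha> in auto)
  obtain l :: nat and e f :: "nat \<Rightarrow> 'a"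
    where ob': "ordered_basis (concat (map (\<lambda>k. [e k, f k]) [0..<Suc l]) @ [x, y])"
      and De: "\<And>k. k \<le> l \<Longrightarrow> D (e k) = - (\<alpha> + real k) *\<^sub>R f k"
      and Df: "\<And>k. k \<le> l \<Longrightarrow> D (f k) = (\<alpha> + real k) *\<^sub>R e k"
      and step: "\<And>k. k < l \<Longrightarrow> br (e k) (e (Suc k)) = x \<and> br (e k) (f (Suc k)) = y \<and>
           br (f k) (e (Suc k)) = - y \<and> br (f k) (f (Suc k)) = x"
      and zero: "\<And>j k u v. j \<le> l \<Longrightarrow> k \<le> l \<Longrightarrow> j \<noteq> Suc k \<Longrightarrow> k \<noteq> Suc j \<Longrightarrow>
           u \<in> {e j, f j} \<Longrightarrow> v \<in> {e k, f k} \<Longrightarrow> br u v = 0"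
    by (rule normal_form_basis, rule that) assumption+
  define es' where "es' = concat (map (\<lambda>k. [e k, f k]) [0..<Suc l])"
  have len': "length es' = 2 * (l + 1)" using length_concat_pairs[of e f "Suc l"] by (simp add: es'_def)
  note ob'' = ob'[folded es'_def]
  have "DIM('a) = card (set (es' @ [x, y]))"
    using ob'' dim_eq_card_independent[of "set (es' @ [x, y])"] dim_span[of "set (es' @ [x, y])"]
    by (simp add: ordered_basis_def)
  also have "\<dots> = 2 * (l + 1) + 2"
    using ob'' distinct_card[of "es' @ [x, y]"] len' by (simp only: ordered_basis_def) simp
  finally have nl: "n = 2 * (l + 1)" using assms(1) by (simp add: nilpotent_type_2_def)
  \<comment> \<open>Here n > 2 matters: with l = 0 there would be no block and \<open>?T1\<close>
    would be zero.\<close>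
  have l: "l \<ge> 1" using assms(2) nl by arith
  have ab': "adapted_basis br n es' x y"
    using ob'' len' nl comm by (simp add: adapted_basis_def)
  let ?cs' = "map (\<lambda>i. \<alpha> + real i - 1) [1..<l+2] @ [1]"
  have "length (es' @ [x, y]) = 2 * length ?cs'" using len' by simp
  moreover have "D ((es' @ [x, y]) ! (2 * k)) = - (?cs' ! k) *\<^sub>R (es' @ [x, y]) ! (2 * k + 1) \<and>
      D ((es' @ [x, y]) ! (2 * k + 1)) = ?cs' ! k *\<^sub>R (es' @ [x, y]) ! (2 * k)" if k: "k < length ?cs'" for k
  proof (cases "k \<le> l")
    case True
    \<comment> \<open>Blocks count from 1 and list positions from 0, so the shift - 1 in the
      coefficient cancels.\<close>
    have "[1..<l+2] ! k = k + 1" using True by (subst nth_upt) auto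
    then have "?cs' ! k = \<alpha> + real k" using True by (simp add: nth_append del: upt_Suc)
    moreover have "es' ! (2 * k) = e k" "es' ! (2 * k + 1) = f k"
      unfolding es'_def using True by (intro nth_concat_pairs; simp)+
    ultimately show ?thesis
      using De[OF True] Df[OF True] True len' by (simp add: nth_append del: upt_Suc)
  next
    case False
    then have "k = l + 1" using k by (simp del: upt_Suc)
    then show ?thesis using Dxy len' by (simp add: nth_append del: upt_Suc)
  qed
  ultimately have "{D'. \<exists>t. has_matrix (es' @ [x, y]) D' (t \<cdot>\<^sub>m diag_block_mat (map (\<lambda>c. c \<cdot>\<^sub>m J2) ?cs'))} =
      range (\<lambda>t v. t *\<^sub>R D v)"
    by (rule has_matrix_rotation_multiples[OF ob'' _ D(1)])
  moreover have "map (\<lambda>i. rep_diag 2 ((\<alpha> + real i - 1) \<cdot>\<^sub>m J2)) [1..<l+2] @ [J2] = map (\<lambda>c. c \<cdot>\<^sub>m J2) ?cs'"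
  proof -
    have "1 \<cdot>\<^sub>m J2 = J2" by (rule eq_matI) auto
    then show ?thesis by (simp add: rep_diag_2 del: upt_Suc)
  qed
  ultimately have mats: "{D'. \<exists>t. has_matrix (es' @ [x, y]) D' (t \<cdot>\<^sub>m diag_block_mat
      (map (\<lambda>i. rep_diag 2 ((\<alpha> + real i - 1) \<cdot>\<^sub>m J2)) [1..<l+2] @ [J2]))} = range (\<lambda>t v. t *\<^sub>R D v)"
    by (simp only:)
  have T': "T = {lin_exp D' | D'. \<exists>t. has_matrix (es' @ [x, y]) D' (t \<cdot>\<^sub>m diag_block_mat
      (map (\<lambda>i. rep_diag 2 ((\<alpha> + real i - 1) \<cdot>\<^sub>m J2)) [1..<l+2] @ [J2]))}" (is "T = {lin_exp D' | D'. ?R D'}")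
  proof -
    have "{lin_exp D' | D'. ?R D'} = lin_exp ` {D'. ?R D'}" by blast
    also have "\<dots> = range E" unfolding mats by (simp only: image_image)
    finally show ?thesis using TE by simp
  qed
  let ?T1 = "alternating_tridiagonal (l + 1) (\<lambda>_. 2) (\<lambda>_. 1\<^sub>m 2 :: real mat)"
  have "described_by br es' x y ?T1 (alternating_tridiagonal (l + 1) (\<lambda>_. 2) (\<lambda>_. J2))"
    unfolding es'_def by (rule described_by_alternating_tridiagonal_2[where br = br and l = l and e = e and f = f,
        OF br_commute step zero])
  moreover have "1\<^sub>m 2 * rep_diag 2 J2 = J2"
    using left_mult_one_mat[OF J2_carrier] by (simp add: rep_diag_2)
  ultimately have descr: "described_by br es' x y ?T1
      (alternating_tridiagonal (l + 1) (\<lambda>_. 2) (\<lambda>i. 1\<^sub>m 2 * rep_diag 2 J2))"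
    by simp
  \<comment> \<open>The first column of each pair already has a nonzero entry: in row 2 for the
    first block, and from the preceding block otherwise.\<close>
  have cols: "col ?T1 (2 * j - 2) \<noteq> 0\<^sub>v n" if j: "j \<in> {1..n div 2}" for j
  proof
    assume 0: "col ?T1 (2 * j - 2) = 0\<^sub>v n"
    obtain k where k: "j = Suc k" using j by (cases j) auto
    have kl: "k \<le> l" using j k nl by auto
    have "?T1 $$ (i, 2 * k) = 0" if "i < n" for i
      using arg_cong[OF 0, of "\<lambda>v. v $ i"] that k kl nl alternating_tridiagonal_2_carrier[of "l + 1" "\<lambda>_. 1\<^sub>m 2"]
      by simp
    moreover have "?T1 $$ (2, 0) = - 1"
      using l by (subst alternating_tridiagonal_2_index) auto
    moreover have "?T1 $$ (2 * (k - 1), 2 * k) = 1" if "k \<noteq> 0"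
      using that kl by (subst alternating_tridiagonal_2_index) auto
    moreover have "2 < n" "2 * (k - 1) < n" using l kl nl by auto
    ultimately show False by (cases "k = 0") force+
  qed
  have echelon: "almost_echelon 1 (1\<^sub>m 1)"
    unfolding almost_echelon_def using identity_with_zero_rows_one prepend_zero_cols_0 by metis
  \<comment> \<open>All blocks have size 2, all ranks are 1, every complex block is the 1 by 1
    identity, and no zero columns are prepended.\<close>
  show ?thesis
    by (rule exI[of _ l], rule exI[of _ es'], rule exI[of _ x], rule exI[of _ y],
        rule exI[of _ "\<lambda>_. 2"], rule exI[of _ "\<lambda>_. 1"], rule exI[of _ "\<lambda>_. 1\<^sub>m 1"], rule exI[of _ "\<lambda>_. 1\<^sub>m 2"],
        rule exI[of _ ?T1], rule exI[of _ "alternating_tridiagonal (l + 1) (\<lambda>_. 2) (\<lambda>i. 1\<^sub>m 2 * rep_diag 2 J2)"],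
        intro conjI ballI impI refl ab' T' descr)
      (use nl cols echelon identity_with_zero_rows_one in
        \<open>auto simp: real_form_one prepend_zero_cols_0 intro: exI[of _ 0] simp del: One_nat_def\<close>)
qed

end
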